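(* Any Tortkara algebra generated by two elements is special.
   Context: All algebras are over a field $\mathbf{K}$ of characteristic $0$. A (right-)Zinbiel algebra is an algebra with product $\circ$ satisfying $a\circ(b\circ c)=(a\circ b+b\circ a)\circ c$. A Tortkara algebra is an anticommutative algebra satisfying $(ab)(cb)=J(a,b,c)b$, where $J(a,b,c)=(ab)c+(bc)a+(ca)b$. For any Zinbiel algebra $A$, the algebra $A^{(-)}$ with the same vector space and product $[a,b]=a\circ b-b\circ a$ is a Tortkara algebra. A Tortkara algebra $B$ is called special if there exists a Zinbiel algebra $A$ such that $B$ is (isomorphic to) a subalgebra of $A^{(-)}$. *)

theory Defs
  imports Complex_Main "HOL-Library.Poly_Mapping"
begin

locale nonassoc_algebra = vector_space scale
  for scale :: "'k::field_char_0 \<Rightarrow> 'a::ab_group_add \<Rightarrow> 'a"  (infixr \<open>*s\<close> 75) +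
  fixes mult :: "'a \<Rightarrow> 'a \<Rightarrow> 'a"  (infixl \<open>\<cdot>\<close> 70)
  assumes mult_add_left: "(a + b) \<cdot> c = a \<cdot> c + b \<cdot> c"
    and mult_add_right: "a \<cdot> (b + c) = a \<cdot> b + a \<cdot> c"
    and mult_scale_left: "(r *s a) \<cdot> b = r *s (a \<cdot> b)"
    and mult_scale_right: "a \<cdot> (r *s b) = r *s (a \<cdot> b)"

locale zinbiel_algebra = nonassoc_algebra scale mult
  for scale :: "'k::field_char_0 \<Rightarrow> 'a::ab_group_add \<Rightarrow> 'a"  (infixr \<open>*s\<close> 75)
    and mult :: "'a \<Rightarrow> 'a \<Rightarrow> 'a"  (infixl \<open>\<cdot>\<close> 70) +
  assumes zinbiel: "a \<cdot> (b \<cdot> c) = (a \<cdot> b + b \<cdot> a) \<cdot> c"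

definition jacobian :: "('a::ab_group_add \<Rightarrow> 'a \<Rightarrow> 'a) \<Rightarrow> 'a \<Rightarrow> 'a \<Rightarrow> 'a \<Rightarrow> 'a"
  where "jacobian mult a b c = mult (mult a b) c + mult (mult b c) a + mult (mult c a) b"

locale tortkara_algebra = nonassoc_algebra scale mult
  for scale :: "'k::field_char_0 \<Rightarrow> 'a::ab_group_add \<Rightarrow> 'a"  (infixr \<open>*s\<close> 75)
    and mult :: "'a \<Rightarrow> 'a \<Rightarrow> 'a"  (infixl \<open>\<cdot>\<close> 70) +
  assumes anticommutative: "a \<cdot> b = - (b \<cdot> a)"
    and tortkara: "(a \<cdot> b) \<cdot> (c \<cdot> b) = jacobian mult a b c \<cdot> b"

definition commutator :: "('a::ab_group_add \<Rightarrow> 'a \<Rightarrow> 'a) \<Rightarrow> 'a \<Rightarrow> 'a \<Rightarrow> 'a"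
  where "commutator mult a b = mult a b - mult b a"

definition subalgebra ::
    "('k::field_char_0 \<Rightarrow> 'a::ab_group_add \<Rightarrow> 'a) \<Rightarrow> ('a \<Rightarrow> 'a \<Rightarrow> 'a) \<Rightarrow> 'a set \<Rightarrow> bool"
  where "subalgebra scale mult S \<longleftrightarrow>
    module.subspace scale S \<and> (\<forall>a\<in>S. \<forall>b\<in>S. mult a b \<in> S)"

definition generated_by_two ::
    "('k::field_char_0 \<Rightarrow> 'a::ab_group_add \<Rightarrow> 'a) \<Rightarrow> ('a \<Rightarrow> 'a \<Rightarrow> 'a) \<Rightarrow> bool"
  where "generated_by_two scale mult \<longleftrightarrow>
    (\<exists>x y. subalgebra scale mult hull {x, y} = UNIV)"

definition algebra_hom ::
    "('k::field_char_0 \<Rightarrow> 'b::ab_group_add \<Rightarrow> 'b) \<Rightarrow> ('b \<Rightarrow> 'b \<Rightarrow> 'b)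
      \<Rightarrow> ('k \<Rightarrow> 'a::ab_group_add \<Rightarrow> 'a) \<Rightarrow> ('a \<Rightarrow> 'a \<Rightarrow> 'a) \<Rightarrow> ('b \<Rightarrow> 'a) \<Rightarrow> bool"
  where "algebra_hom scaleB multB scaleA multA f \<longleftrightarrow>
    Vector_Spaces.linear scaleB scaleA f \<and> (\<forall>x y. f (multB x y) = multA (f x) (f y))"

definition special_in ::
    "('k::field_char_0 \<Rightarrow> 'b::ab_group_add \<Rightarrow> 'b) \<Rightarrow> ('b \<Rightarrow> 'b \<Rightarrow> 'b)
      \<Rightarrow> ('k \<Rightarrow> 'a::ab_group_add \<Rightarrow> 'a) \<Rightarrow> ('a \<Rightarrow> 'a \<Rightarrow> 'a) \<Rightarrow> bool"
  where "special_in scaleB multB scaleA multA \<longleftrightarrow>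
    (\<exists>S f. subalgebra scaleA (commutator multA) S
      \<and> algebra_hom scaleB multB scaleA (commutator multA) f
      \<and> bij_betw f UNIV S)"

text \<open>
  HOL cannot quantify existentially over the type carrying the Zinbiel algebra, so
  \<open>special\<close> asks for one carried by the finitely supported functions on words over \<open>'b\<close>
  (where the free Zinbiel algebra on the set \<open>'b\<close> also lives). This is no restriction: by the
  lemma \<open>special_if_special_in\<close> below, an algebra that embeds in the commutator algebra of a
  Zinbiel algebra on any type whatsoever is special in this sense.
\<close>

definition special ::
    "('k::field_char_0 \<Rightarrow> 'b::ab_group_add \<Rightarrow> 'b) \<Rightarrow> ('b \<Rightarrow> 'b \<Rightarrow> 'b) \<Rightarrow> bool"
  where "special scaleB multB \<longleftrightarrow>
    (\<exists>(scaleA :: 'k \<Rightarrow> ('b list \<Rightarrow>\<^sub>0 'k) \<Rightarrow> ('b list \<Rightarrow>\<^sub>0 'k)) multA.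
      zinbiel_algebra scaleA multA \<and> special_in scaleB multB scaleA multA)"

fun left_normed :: "('b \<Rightarrow> 'a::ab_group_add) \<Rightarrow> ('a \<Rightarrow> 'a \<Rightarrow> 'a) \<Rightarrow> 'b list \<Rightarrow> 'a"
  where
    "left_normed f mult [] = 0"
  | "left_normed f mult (b # bs) = foldl (\<lambda>a c. mult a (f c)) (f b) bs"

lemma left_normed_snoc:
  "w \<noteq> [] \<Longrightarrow> left_normed f mult (w @ [b]) = mult (left_normed f mult w) (f b)"
  by (cases w) auto

context zinbiel_algebra
begin

lemma mult_zero_left: "0 \<cdot> a = 0"
  using mult_add_left[of 0 0 a] by simp

lemma mult_zero_right: "a \<cdot> 0 = 0"
  using mult_add_right[of a 0 0] by simp

lemma mult_sum_left: "sum g I \<cdot> a = (\<Sum>i\<in>I. g i \<cdot> a)"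
  by (induction I rule: infinite_finite_induct) (auto simp: mult_zero_left mult_add_left)

lemma mult_sum_right: "a \<cdot> sum g I = (\<Sum>i\<in>I. a \<cdot> g i)"
  by (induction I rule: infinite_finite_induct) (auto simp: mult_zero_right mult_add_right)

lemma span_mult_right:
  assumes "x \<in> span X" "\<And>y. y \<in> X \<Longrightarrow> y \<cdot> b \<in> span X"
  shows "x \<cdot> b \<in> span X"
  using assms(1)
proof (induction rule: span_induct_alt)
  case base
  show ?case by (simp add: mult_zero_left span_zero)
next
  case (step c y z)
  then show ?case
    by (simp add: mult_add_left mult_scale_left span_add span_scale assms(2))
qed

lemma left_normed_span_mult:
  fixes f :: "'b \<Rightarrow> 'a"
  defines "X \<equiv> range (left_normed f mult)"
  assumes "x \<in> span X" "y \<in> span X"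
  shows "x \<cdot> y \<in> span X"
proof -
  have gen: "z \<cdot> f b \<in> span X" if z: "z \<in> X" for z b
  proof -
    obtain w where w: "z = left_normed f mult w" using z by (auto simp: X_def)
    show ?thesis
    proof (cases "w = []")
      case True
      then show ?thesis using w by (simp add: mult_zero_left span_zero)
    next
      case False
      then have "z \<cdot> f b = left_normed f mult (w @ [b])" by (simp add: w left_normed_snoc)
      then show ?thesis by (simp add: X_def span_base)
    qed
  qed
  have genspan: "z \<cdot> f b \<in> span X" if "z \<in> span X" for z b
    using span_mult_right[OF that gen] .
  have word: "left_normed f mult u \<cdot> left_normed f mult v \<in> span X" for u v
  proof (induction "length u + length v" arbitrary: u v rule: less_induct)
    case less
    show ?case
    proof (cases v rule: rev_cases)
      case Nil
      then show ?thesis by (simp add: mult_zero_right span_zero)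
    next
      case (snoc v' b)
      show ?thesis
      proof (cases "v' = []")
        case True
        then show ?thesis using snoc gen[of "left_normed f mult u" b] by (simp add: X_def)
      next
        case False
        have "left_normed f mult u \<cdot> left_normed f mult v' \<in> span X"
          "left_normed f mult v' \<cdot> left_normed f mult u \<in> span X"
          using less snoc by auto
        then show ?thesis
          by (simp add: snoc left_normed_snoc[OF False] zinbiel genspan span_add)
      qed
    qed
  qed
  have "x \<cdot> v \<in> span X" if "v \<in> X" for v
    using assms(2)
  proof (induction rule: span_induct_alt)
    case base
    show ?case by (simp add: mult_zero_left span_zero)
  next
    case (step c y z)
    then have "y \<cdot> v \<in> span X" using that word by (auto simp: X_def)
    with step show ?case by (simp add: mult_add_left mult_scale_left span_add span_scale)
  qed
  with assms(3) show ?thesis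
  proof (induction rule: span_induct_alt)
    case base
    show ?case by (simp add: mult_zero_right span_zero)
  next
    case (step c y z)
    then show ?case by (simp add: mult_add_right mult_scale_right span_add span_scale)
  qed
qed

end

lemma vector_space_poly_mapping:
  "vector_space (\<lambda>(c::'k::field) (p :: 'w \<Rightarrow>\<^sub>0 'k). Poly_Mapping.map ((*) c) p)"
proof -
  have "Poly_Mapping.lookup (Poly_Mapping.map ((*) c) p) w = c * Poly_Mapping.lookup p w"
    for c :: 'k and p :: "'w \<Rightarrow>\<^sub>0 'k" and w
    by (simp add: map.rep_eq when_def)
  then show ?thesis
    by unfold_locales (auto intro!: poly_mapping_eqI simp: lookup_add algebra_simps)
qed

lemma special_if_special_in:
  fixes scaleB :: "'k::field_char_0 \<Rightarrow> 'b::ab_group_add \<Rightarrow> 'b"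
    and scaleA :: "'k \<Rightarrow> 'a::ab_group_add \<Rightarrow> 'a"
  assumes A: "zinbiel_algebra scaleA multA"
    and special: "special_in scaleB multB scaleA multA"
  shows "special scaleB multB"
proof -
  interpret A: zinbiel_algebra scaleA multA by (rule A)
  obtain S f where hom: "algebra_hom scaleB multB scaleA (commutator multA) f"
    and bij: "bij_betw f UNIV S"
    using special by (auto simp: special_in_def)
  have inj: "inj f" using bij by (simp add: bij_betw_def)
  have flin: "Vector_Spaces.linear scaleB scaleA f" using hom by (simp add: algebra_hom_def)
  interpret f: Vector_Spaces.linear scaleB scaleA f by (rule flin)
  define sP where "sP = (\<lambda>(c::'k) (p :: 'b list \<Rightarrow>\<^sub>0 'k). Poly_Mapping.map ((*) c) p)"
  interpret P: vector_space sP unfolding sP_def by (rule vector_space_poly_mapping)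
  interpret PA: vector_space_pair sP scaleA ..
  define L where "L = left_normed f multA"
  define psi where "psi = (\<lambda>p :: 'b list \<Rightarrow>\<^sub>0 'k.
    \<Sum>w\<in>Poly_Mapping.keys p. scaleA (Poly_Mapping.lookup p w) (L w))"
  have psi_superset: "psi p = (\<Sum>w\<in>F. scaleA (Poly_Mapping.lookup p w) (L w))"
    if "finite F" "Poly_Mapping.keys p \<subseteq> F" for p F
    unfolding psi_def using that
    by (intro sum.mono_neutral_left) (auto simp: in_keys_iff)
  have lookup_sP: "Poly_Mapping.lookup (sP c p) w = c * Poly_Mapping.lookup p w" for c p w
    by (simp add: sP_def map.rep_eq when_def)
  have psi_lin: "Vector_Spaces.linear sP scaleA psi"
  proof unfold_locales
    fix p q :: "'b list \<Rightarrow>\<^sub>0 'k"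
    let ?F = "Poly_Mapping.keys p \<union> Poly_Mapping.keys q"
    have "psi (p + q) = (\<Sum>w\<in>?F. scaleA (Poly_Mapping.lookup (p + q) w) (L w))"
      by (intro psi_superset keys_add) auto
    also have "\<dots> = psi p + psi q"
      by (simp add: psi_superset[of ?F p] psi_superset[of ?F q] lookup_add
          A.scale_left_distrib sum.distrib)
    finally show "psi (p + q) = psi p + psi q" .
  next
    fix c :: 'k and p :: "'b list \<Rightarrow>\<^sub>0 'k"
    have "psi (sP c p) = (\<Sum>w\<in>Poly_Mapping.keys p. scaleA (Poly_Mapping.lookup (sP c p) w) (L w))"
      by (intro psi_superset) (auto simp: in_keys_iff lookup_sP)
    then show "psi (sP c p) = scaleA c (psi p)"
      by (simp add: psi_def lookup_sP A.scale_sum_right)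
  qed
  interpret psi: Vector_Spaces.linear sP scaleA psi by (rule psi_lin)
  have psi_single: "psi (Poly_Mapping.single w 1) = L w" for w
    by (simp add: psi_def)
  have range_psi: "range psi = A.span (range L)"
  proof
    show "range psi \<subseteq> A.span (range L)"
      unfolding psi_def
      by (intro image_subsetI A.span_sum A.span_scale) (simp add: A.span_base)
    have "range L \<subseteq> range psi" using psi_single by (metis image_subsetI rangeI)
    moreover have "A.subspace (range psi)"
      using psi.subspace_image[OF P.subspace_UNIV] .
    ultimately show "A.span (range L) \<subseteq> range psi" by (rule A.span_minimal)
  qed
  obtain sigma where sigma_lin: "Vector_Spaces.linear scaleA sP sigma"
    and sigma: "\<And>v. v \<in> range psi \<Longrightarrow> psi (sigma v) = v"
    using PA.linear_exists_right_inverse_on[OF psi_lin P.subspace_UNIV] by auto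
  interpret sigma: Vector_Spaces.linear scaleA sP sigma by (rule sigma_lin)
  define mP where "mP = (\<lambda>p q. sigma (multA (psi p) (psi q)))"
  have psi_mP: "psi (mP p q) = multA (psi p) (psi q)" for p q
  proof -
    have "multA (psi p) (psi q) \<in> range psi"
      unfolding range_psi unfolding L_def
      by (rule A.left_normed_span_mult) (simp_all flip: L_def range_psi)
    then show ?thesis unfolding mP_def by (rule sigma)
  qed
  have mP_app: "mP p q = sigma (multA (psi p) (psi q))" for p q
    by (simp add: mP_def)
  have zin: "zinbiel_algebra sP mP"
  proof unfold_locales
    fix a b c
    show "mP a (mP b c) = mP (mP a b + mP b a) c"
      unfolding mP_app[of a "mP b c"] mP_app[of "mP a b + mP b a" c]
      by (simp add: psi_mP psi.add A.zinbiel)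
  qed (simp_all add: mP_def psi.add sigma.add psi.scale sigma.scale A.mult_add_left
      A.mult_add_right A.mult_scale_left A.mult_scale_right)
  have f_range: "f x \<in> range psi" for x
    using psi_single[of "[x]"] by (metis L_def foldl_Nil left_normed.simps(2) rangeI)
  define g where "g = sigma \<circ> f"
  have psi_g: "psi (g x) = f x" for x using sigma[OF f_range] by (simp add: g_def)
  have glin: "Vector_Spaces.linear scaleB sP g"
    unfolding g_def using Vector_Spaces.linear_compose[OF flin sigma_lin] .
  have gmult: "g (multB x y) = commutator mP (g x) (g y)" for x y
    using hom
    by (simp add: algebra_hom_def commutator_def mP_def psi_g sigma.diff[symmetric])
      (simp add: g_def)
  have ginj: "inj g" using inj psi_g by (metis injD injI)
  interpret g: Vector_Spaces.linear scaleB sP g by (rule glin)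
  have "subalgebra sP (commutator mP) (range g)"
    using g.subspace_image[OF f.vs1.subspace_UNIV] gmult
    unfolding subalgebra_def by (metis (no_types, lifting) imageE rangeI)
  moreover have "algebra_hom scaleB multB sP (commutator mP) g"
    using glin gmult by (simp add: algebra_hom_def)
  moreover have "bij_betw g UNIV (range g)" using ginj by (simp add: bij_betw_def)
  ultimately have "special_in scaleB multB sP mP" unfolding special_in_def by blast
  with zin show ?thesis unfolding special_def by blast
qed

end

theory Submission
  imports Defs "HOL-Library.Product_Plus"
begin

text \<open>
  Let \<open>W\<close> be the shuffle algebra on two letters \<open>a\<close>, \<open>b\<close>, which contains the free Zinbiel
  algebra, and let \<open>T \<subseteq> W\<close> be generated by the letters under the bracket; the left-normed
  brackets \<open>[[a, b], x\<^sub>1, \<dots>, x\<^sub>n]\<close> and the letters span \<open>T\<close>. Every identity between left-normed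
  brackets needed to multiply them already follows from the Tortkara identity, and the products
  \<open>a\<^sup>i b\<^sup>j\<close> and \<open>a\<^sup>i b\<^sup>j [[a, b], x\<^sub>1, \<dots>, x\<^sub>n]\<close> form a basis of the polynomial part of \<open>W\<close>: they span it,
  and in each degree there are as many of them as words. Hence an algebra \<open>B\<close> generated by two
  elements is the image of \<open>T\<close> under a linear map \<open>\<rho>\<close> on \<open>W\<close> which kills all \<open>a\<^sup>i b\<^sup>j t\<close> with \<open>t \<in> T\<close>
  and \<open>i + j > 0\<close>. If \<open>I\<close> is the kernel of \<open>\<rho>\<close> on \<open>T\<close>, then the span \<open>J\<close> of all \<open>a\<^sup>i b\<^sup>j t\<close> with
  \<open>t \<in> I\<close> is a Zinbiel ideal; as \<open>\<rho>\<close> vanishes on \<open>J\<close>, we have \<open>J \<inter> T = I\<close>, and \<open>B \<cong> T / I\<close> embeds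
  into the quotient by \<open>J\<close>.
\<close>

section \<open>Products of left-normed commutators\<close>

text \<open>The head of the list is the letter bracketed last, as in the words of the shuffle
  algebra. The initial bracket of the two generators is implicit, so a word of length
  \<open>n\<close> gives an element of degree \<open>n + 2\<close>.\<close>

primrec left_normed_commutator :: "('a \<Rightarrow> 'a \<Rightarrow> 'a) \<Rightarrow> (bool \<Rightarrow> 'a) \<Rightarrow> bool list \<Rightarrow> 'a"
  where
    "left_normed_commutator mult c [] = mult (c True) (c False)"
  | "left_normed_commutator mult c (x # w) = mult (left_normed_commutator mult c w) (c x)"

context nonassoc_algebra
begin

lemma mult_zero_left [simp]: "0 \<cdot> a = 0"
  using mult_add_left[of 0 0 a] by simp

lemma mult_zero_right [simp]: "a \<cdot> 0 = 0"
  using mult_add_right[of a 0 0] by simp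

lemma mult_minus_left: "(- a) \<cdot> b = - (a \<cdot> b)"
  using mult_add_left[of a "- a" b] by (simp add: eq_neg_iff_add_eq_0 add.commute)

lemma mult_minus_right: "a \<cdot> (- b) = - (a \<cdot> b)"
  using mult_add_right[of a b "- b"] by (simp add: eq_neg_iff_add_eq_0 add.commute)

lemma mult_diff_left: "(a - b) \<cdot> c = a \<cdot> c - b \<cdot> c"
  using mult_add_left[of a "- b" c] by (simp add: mult_minus_left)

lemma mult_diff_right: "a \<cdot> (b - c) = a \<cdot> b - a \<cdot> c"
  using mult_add_right[of a b "- c"] by (simp add: mult_minus_right)

lemma mult_span_left:
  assumes "s \<in> span S" "subspace X" "\<And>t. t \<in> S \<Longrightarrow> t \<cdot> y \<in> X"
  shows "s \<cdot> y \<in> X"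
  using assms(1)
  by (induction rule: span_induct_alt)
    (auto simp: mult_add_left mult_scale_left assms subspace_0 subspace_add subspace_scale)

lemma mult_span_right:
  assumes "s \<in> span S" "subspace X" "\<And>t. t \<in> S \<Longrightarrow> y \<cdot> t \<in> X"
  shows "y \<cdot> s \<in> X"
  using assms(1)
  by (induction rule: span_induct_alt)
    (auto simp: mult_add_right mult_scale_right assms subspace_0 subspace_add subspace_scale)

abbreviation left_normed_span :: "(bool \<Rightarrow> 'a) \<Rightarrow> nat \<Rightarrow> 'a set"
  where "left_normed_span c n \<equiv> span (left_normed_commutator (\<cdot>) c ` {w. length w = n})"

definition two_generated_span :: "(bool \<Rightarrow> 'a) \<Rightarrow> 'a set"
  where "two_generated_span c = span (range c \<union> range (left_normed_commutator (\<cdot>) c))"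

lemma left_normed_span_Suc:
  assumes "s \<in> left_normed_span c n"
  shows "s \<cdot> c x \<in> left_normed_span c (Suc n)"
proof (rule mult_span_left[OF assms subspace_span])
  fix t assume "t \<in> left_normed_commutator (\<cdot>) c ` {w. length w = n}"
  then obtain w where "length w = n" "t = left_normed_commutator (\<cdot>) c w" by auto
  then have "t \<cdot> c x = left_normed_commutator (\<cdot>) c (x # w)" "length (x # w) = Suc n" by auto
  then show "t \<cdot> c x \<in> left_normed_span c (Suc n)"
    by (metis (mono_tags, lifting) image_eqI mem_Collect_eq span_base)
qed

end

context tortkara_algebra
begin

lemma mult_self [simp]: "a \<cdot> a = 0"
proof -
  have "(1 + 1) *s (a \<cdot> a) = 0"
    using anticommutative[of a a]
    by (simp only: scale_left_distrib scale_one) (metis add.right_inverse)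
  then show ?thesis by (simp only: scale_eq_0_iff) auto
qed

lemma jacobian_swap: "jacobian (\<cdot>) b a c = - jacobian (\<cdot>) a b c"
  using anticommutative[of b a] anticommutative[of a c] anticommutative[of c b]
  by (simp add: jacobian_def mult_minus_left)

text \<open>Polarization in the repeated argument: expand the identity at \<open>b + d\<close> and
  subtract its instances at \<open>b\<close> and \<open>d\<close>.\<close>

lemma tortkara_linearized:
  "(a \<cdot> b) \<cdot> (c \<cdot> d) + (a \<cdot> d) \<cdot> (c \<cdot> b) = jacobian (\<cdot>) a b c \<cdot> d + jacobian (\<cdot>) a d c \<cdot> b"
  using tortkara[of a "b + d" c] tortkara[of a b c] tortkara[of a d c]
  by (simp add: jacobian_def mult_add_left mult_add_right algebra_simps)

text \<open>Induction on the total length, then on the length of the left factor. For empty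
  \<open>u\<close> the left factor is a product of generators, empty \<open>v\<close> is reduced to
  this by anticommutativity, and otherwise the outermost letters \<open>x\<close>, \<open>y\<close>
  allow the Tortkara identity (if \<open>x = y\<close>) or its linearization.\<close>

lemma left_normed_commutator_mult:
  "left_normed_commutator (\<cdot>) c u \<cdot> left_normed_commutator (\<cdot>) c v
    \<in> left_normed_span c (length u + length v + 2)"
proof (induction "(length u + length v, length u)" arbitrary: u v
    rule: wf_induct_rule[OF wf_lex_prod[OF wf_less_than wf_less_than]])
  case (1 u v)
  let ?g = "left_normed_commutator (\<cdot>) c" and ?M = "left_normed_span c"
  have IH: "?g u' \<cdot> ?g v' \<in> ?M (length u' + length v' + 2)"
    if "length u' + length v' < length u + length v
      \<or> length u' + length v' = length u + length v \<and> length u' < length u" for u' v'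
    using 1 that by auto
  have base: "?g w \<in> ?M (length w)" for w by (auto intro: span_base)
  have IHspan: "?g u' \<cdot> s \<in> ?M (length u' + n + 2)"
    if "length u' + n < length u + length v
      \<or> length u' + n = length u + length v \<and> length u' < length u" "s \<in> ?M n" for u' n s
    using that(2) by (rule mult_span_right[OF _ subspace_span]) (use IH that(1) in auto)
  note closed = span_add span_diff span_neg left_normed_span_Suc
  \<comment> \<open>\<open>?g []\<close> is the product of both generators, so either of them can
    serve as the repeated argument of the identity.\<close>
  have zsx: "?g [] \<cdot> (?g v' \<cdot> c x) \<in> ?M (length v' + 3)"
    if "length v' < length u + length v" for v' x
  proof -
    define s where "s = ?g v'"
    have zs: "?g [] \<cdot> s \<in> ?M (length v' + 2)" using IH[of "[]" v'] that by (simp add: s_def)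
    have s: "s \<in> ?M (length v')" by (simp add: s_def base)
    have "jacobian (\<cdot>) (c True) (c False) s = ?g [] \<cdot> s - (s \<cdot> c False) \<cdot> c True + (s \<cdot> c True) \<cdot> c False"
      using anticommutative[of "c False" s] by (simp add: jacobian_def mult_minus_left)
    then have J: "jacobian (\<cdot>) (c True) (c False) s \<in> ?M (length v' + 2)"
      using zs s by (auto intro!: closed simp: numeral_2_eq_2)
    have "?g [] \<cdot> (s \<cdot> c False) = jacobian (\<cdot>) (c True) (c False) s \<cdot> c False"
      by (simp add: tortkara)
    moreover have "?g [] \<cdot> (s \<cdot> c True) = jacobian (\<cdot>) (c True) (c False) s \<cdot> c True"
      using tortkara[of "c False" "c True" s] anticommutative[of "c False" "c True"]
        jacobian_swap[of "c False" "c True" s]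
      by (simp add: mult_minus_left)
    ultimately have "?g [] \<cdot> (s \<cdot> c x) = jacobian (\<cdot>) (c True) (c False) s \<cdot> c x" by (cases x) auto
    then show ?thesis using left_normed_span_Suc[OF J] by (simp add: s_def numeral_3_eq_3)
  qed
  show ?case
  proof (cases u)
    case Nil
    show ?thesis
    proof (cases v)
      case Nil
      with \<open>u = []\<close> show ?thesis by (simp add: span_zero)
    next
      case (Cons x v')
      with Nil zsx[of v' x] show ?thesis by (simp add: numeral_3_eq_3)
    qed
  next
    case u: (Cons x u')
    show ?thesis
    proof (cases v)
      case Nil
      then have "?g [] \<cdot> ?g u \<in> ?M (length u + length v + 2)" using IH[of "[]" u] u by simp
      then have "- (?g [] \<cdot> ?g u) \<in> ?M (length u + length v + 2)" by (rule span_neg)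
      then show ?thesis using Nil anticommutative[of "?g u" "?g []"] by simp
    next
      case v: (Cons y v')
      define s t where "s = ?g u'" and "t = ?g v'"
      define n where "n = length u' + length v'"
      have len: "length u = Suc (length u')" "length v = Suc (length v')" using u v by auto
      have uv: "?g u = s \<cdot> c x" "?g v = t \<cdot> c y" by (simp_all add: u v s_def t_def)
      have st: "s \<cdot> t \<in> ?M (n + 2)" "t \<cdot> s \<in> ?M (n + 2)"
        using IH[of u' v'] IH[of v' u'] len by (simp_all add: s_def t_def n_def add.commute)
      have sxt: "(s \<cdot> c i) \<cdot> t \<in> ?M (n + 3)" for i
        using IH[of "i # u'" v'] len by (simp add: s_def t_def n_def numeral_3_eq_3)
      have tys: "(t \<cdot> c i) \<cdot> s \<in> ?M (n + 3)" for i
        using IH[of "i # v'" u'] len by (simp add: s_def t_def n_def numeral_3_eq_3 add.commute)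
      have Suc: "q \<cdot> c i \<in> ?M (n + 3)" if "q \<in> ?M (n + 2)" for q i
        using left_normed_span_Suc[OF that, of i] by (simp add: numeral_3_eq_3)
      have Suc': "q \<cdot> c i \<in> ?M (n + 4)" if "q \<in> ?M (n + 3)" for q i
        using left_normed_span_Suc[OF that, of i] by (simp add: eval_nat_numeral)
      have J1: "jacobian (\<cdot>) s (c i) t \<cdot> c j \<in> ?M (n + 4)" for i j
      proof -
        have "jacobian (\<cdot>) s (c i) t = (s \<cdot> c i) \<cdot> t - (t \<cdot> c i) \<cdot> s + (t \<cdot> s) \<cdot> c i"
          using anticommutative[of "c i" t] by (simp add: jacobian_def mult_minus_left)
        then show ?thesis using sxt tys Suc st by (auto intro!: Suc' span_add span_diff)
      qed
      have "(s \<cdot> c x) \<cdot> (t \<cdot> c y) \<in> ?M (n + 4)"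
      proof (cases "x = y")
        case True
        then show ?thesis using J1[of y y] by (simp add: tortkara)
      next
        case False
        have pq: "c x \<cdot> c y = ?g [] \<or> c x \<cdot> c y = - ?g []"
          using False anticommutative[of "c x" "c y"] by (cases x; cases y) auto
        \<comment> \<open>The total length is again that of \<open>u\<close> and \<open>v\<close>;
          only the left factor has become shorter. This is why the order is lexicographic.\<close>
        have "?g [] \<cdot> (t \<cdot> s) \<in> ?M (n + 4)"
          using IHspan[of "[]" "n + 2", OF _ st(2)] len u by (simp add: n_def eval_nat_numeral)
        then have zts: "(c x \<cdot> c y) \<cdot> (t \<cdot> s) \<in> ?M (n + 4)"
          using pq by (auto simp: mult_minus_left dest: span_neg)
        have t: "t \<in> ?M (length v')" by (simp add: t_def base)
        have "?g [] \<cdot> t \<in> ?M (length v' + 2)"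
          using IH[of "[]" v'] len by (simp add: t_def)
        then have zt: "(c x \<cdot> c y) \<cdot> t \<in> ?M (length v' + 2)"
          using pq by (auto simp: mult_minus_left dest: span_neg)
        have "jacobian (\<cdot>) (c x) (c y) t = (c x \<cdot> c y) \<cdot> t - (t \<cdot> c y) \<cdot> c x + (t \<cdot> c x) \<cdot> c y"
          using anticommutative[of "c y" t] by (simp add: jacobian_def mult_minus_left)
        then have J2: "jacobian (\<cdot>) (c x) (c y) t \<in> ?M (length v' + 2)"
          using zt t by (auto intro!: closed simp: numeral_2_eq_2)
        have "s \<cdot> jacobian (\<cdot>) (c x) (c y) t \<in> ?M (n + 4)"
          using IHspan[of u' "length v' + 2", OF _ J2] len
          by (simp add: s_def n_def eval_nat_numeral)
        then have J2s: "- (jacobian (\<cdot>) (c x) (c y) t \<cdot> s) \<in> ?M (n + 4)"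
          using anticommutative[of s] by simp
        have J3: "jacobian (\<cdot>) (c x) s t \<cdot> c y = - (jacobian (\<cdot>) s (c x) t \<cdot> c y)"
          using jacobian_swap[of s "c x" t] by (simp add: mult_minus_left)
        \<comment> \<open>the linearized identity trades \<open>u\<close> for the shorter left factors \<open>[]\<close> and \<open>u'\<close>\<close>
        have "(s \<cdot> c x) \<cdot> (t \<cdot> c y) = - ((c x \<cdot> s) \<cdot> (t \<cdot> c y))"
          using anticommutative[of s "c x"] by (simp add: mult_minus_left)
        also have "\<dots> = (c x \<cdot> c y) \<cdot> (t \<cdot> s) + - (jacobian (\<cdot>) (c x) (c y) t \<cdot> s)
            + jacobian (\<cdot>) s (c x) t \<cdot> c y"
          using tortkara_linearized[of "c x" "c y" t s] J3
          by (simp add: algebra_simps)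
        also have "\<dots> \<in> ?M (n + 4)" by (intro span_add zts J2s J1)
        finally show ?thesis .
      qed
      then show ?thesis by (simp add: uv len n_def eval_nat_numeral)
    qed
  qed
qed

lemma subalgebra_two_generated_span: "subalgebra scale (\<cdot>) (two_generated_span c)"
proof -
  let ?g = "left_normed_commutator (\<cdot>) c" and ?N = "two_generated_span c"
  have N: "subspace ?N" by (simp add: two_generated_span_def)
  have g: "?g w \<in> ?N" for w by (auto simp: two_generated_span_def intro: span_base)
  have M: "left_normed_span c n \<subseteq> ?N" for n
    unfolding two_generated_span_def by (rule span_mono) auto
  have gg: "s \<cdot> t \<in> ?N" if st: "s \<in> range c \<union> range ?g" "t \<in> range c \<union> range ?g" for s t
  proof -
    have cc: "c x \<cdot> c y \<in> ?N" for x y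
      using g[of "[]"] subspace_neg[OF N g[of "[]"]] anticommutative[of "c False" "c True"]
      by (cases x; cases y) (simp_all add: subspace_0[OF N])
    have gc: "?g w \<cdot> c x \<in> ?N" for w x using g[of "x # w"] by simp
    have cg: "c x \<cdot> ?g w \<in> ?N" for w x
      using subspace_neg[OF N gc[of w x]] anticommutative[of "c x" "?g w"] by simp
    have "?g u \<cdot> ?g v \<in> ?N" for u v
      using left_normed_commutator_mult[of c u v] M by blast
    then show ?thesis using st cc gc cg by auto
  qed
  have "s \<cdot> t \<in> ?N" if st: "s \<in> ?N" "t \<in> ?N" for s t
  proof (rule mult_span_left[OF st(1)[unfolded two_generated_span_def] N])
    fix s assume "s \<in> range c \<union> range ?g"
    then show "s \<cdot> t \<in> ?N"
      using mult_span_right[OF st(2)[unfolded two_generated_span_def] N] gg by blast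
  qed
  with N show ?thesis by (simp add: subalgebra_def)
qed

end

section \<open>The shuffle algebra\<close>

text \<open>Coefficient of a word in the shuffle product: the head letter comes from one of the
  factors, so removing it is a derivation. The recursion is on the word, so supports may be
  infinite.\<close>

fun shuffle_coeff :: "('x list \<Rightarrow> 'k::comm_ring_1) \<Rightarrow> ('x list \<Rightarrow> 'k) \<Rightarrow> 'x list \<Rightarrow> 'k"
  where
    "shuffle_coeff f g [] = f [] * g []"
  | "shuffle_coeff f g (x # w) =
      shuffle_coeff (\<lambda>v. f (x # v)) g w + shuffle_coeff f (\<lambda>v. g (x # v)) w"

lemma shuffle_coeff_add_left:
  "shuffle_coeff (\<lambda>v. f v + f' v) g w = shuffle_coeff f g w + shuffle_coeff f' g w"
  by (induction w arbitrary: f f' g) (simp_all add: algebra_simps)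

lemma shuffle_coeff_commute: "shuffle_coeff f g w = shuffle_coeff g f w"
  by (induction w arbitrary: f g) (simp_all add: mult.commute add.commute)

lemma shuffle_coeff_add_right:
  "shuffle_coeff g (\<lambda>v. f v + f' v) w = shuffle_coeff g f w + shuffle_coeff g f' w"
  by (simp add: shuffle_coeff_commute[of g] shuffle_coeff_add_left)

lemma shuffle_coeff_assoc:
  "shuffle_coeff (shuffle_coeff f g) h w = shuffle_coeff f (shuffle_coeff g h) w"
  by (induction w arbitrary: f g h)
    (simp_all add: mult.assoc add.assoc shuffle_coeff_add_left shuffle_coeff_add_right)

lemma shuffle_coeff_zero_left: "shuffle_coeff (\<lambda>v. 0) g w = 0"
  by (induction w arbitrary: g) simp_all

lemma shuffle_coeff_const_left:
  "shuffle_coeff (\<lambda>v. if v = [] then c else 0) g w = c * g w"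
  by (induction w arbitrary: g) (simp_all add: shuffle_coeff_zero_left)

text \<open>
  The head of a list is the last letter of the corresponding word, so that \<open>deriv x\<close> below
  removes a last letter \<open>x\<close> and the Zinbiel product \<open>f \<circ> g\<close> satisfies
  \<open>deriv x (f \<circ> g) = f * deriv x g\<close>: formally, \<open>f \<circ> g\<close> is the iterated integral \<open>\<integral> f dg\<close>.
\<close>

typedef 'k shuffle_series = "UNIV :: (bool list \<Rightarrow> 'k) set"
  morphisms coeff Series ..

setup_lifting type_definition_shuffle_series

instantiation shuffle_series :: (comm_ring_1) comm_ring_1
begin

lift_definition zero_shuffle_series :: "'a shuffle_series" is "\<lambda>w. 0" .
lift_definition one_shuffle_series :: "'a shuffle_series" is "\<lambda>w. if w = [] then 1 else 0" .
lift_definition uminus_shuffle_series :: "'a shuffle_series \<Rightarrow> 'a shuffle_series" is "\<lambda>f w. - f w" .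
lift_definition plus_shuffle_series :: "'a shuffle_series \<Rightarrow> 'a shuffle_series \<Rightarrow> 'a shuffle_series"
  is "\<lambda>f g w. f w + g w" .
lift_definition minus_shuffle_series :: "'a shuffle_series \<Rightarrow> 'a shuffle_series \<Rightarrow> 'a shuffle_series"
  is "\<lambda>f g w. f w - g w" .
lift_definition times_shuffle_series :: "'a shuffle_series \<Rightarrow> 'a shuffle_series \<Rightarrow> 'a shuffle_series"
  is shuffle_coeff .

instance
proof
  fix f g h :: "'a shuffle_series"
  show "f * g * h = f * (g * h)" by transfer (rule ext, rule shuffle_coeff_assoc)
  show "f * g = g * f" by transfer (rule ext, rule shuffle_coeff_commute)
  show "1 * f = f" by transfer (rule ext, simp add: shuffle_coeff_const_left)
  show "(f + g) * h = f * h + g * h" by transfer (rule ext, rule shuffle_coeff_add_left)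
  show "(0 :: 'a shuffle_series) \<noteq> 1" by transfer (metis zero_neq_one)
qed (transfer, simp add: fun_eq_iff algebra_simps)+

end

lift_definition deriv :: "bool \<Rightarrow> 'k shuffle_series \<Rightarrow> 'k shuffle_series"
  is "\<lambda>x f w. f (x # w)" .

lift_definition zprod ::
    "'k::comm_ring_1 shuffle_series \<Rightarrow> 'k shuffle_series \<Rightarrow> 'k shuffle_series" (infixl \<open>\<circ>\<^sub>z\<close> 70)
  is "\<lambda>f g w. case w of [] \<Rightarrow> 0 | x # v \<Rightarrow> shuffle_coeff f (\<lambda>u. g (x # u)) v" .

lift_definition const :: "'k::comm_ring_1 \<Rightarrow> 'k shuffle_series"
  is "\<lambda>c w. if w = [] then c else 0" .

lift_definition letter :: "bool \<Rightarrow> 'k::comm_ring_1 shuffle_series"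
  is "\<lambda>x w. if w = [x] then 1 else 0" .

abbreviation const_term :: "'k shuffle_series \<Rightarrow> 'k"
  where "const_term f \<equiv> coeff f []"

text \<open>A series is recovered by integrating its derivatives from its constant term. Identities
  between series are therefore proved by differentiating.\<close>

lemma shuffle_series_eqI:
  assumes "const_term f = const_term g" "\<And>x. deriv x f = deriv x g"
  shows "f = g"
proof -
  have "coeff f w = coeff g w" for w
    using assms by (cases w) (auto simp: deriv.rep_eq Series_inject fun_eq_iff simp flip: coeff_inject)
  then show ?thesis by (simp add: fun_eq_iff flip: coeff_inject)
qed

lemma const_term_simps [simp]:
  "const_term (f + g) = const_term f + const_term g"
  "const_term (f - g) = const_term f - const_term g"
  "const_term (- f) = - const_term f"
  "const_term (f * g) = const_term f * const_term g"
  "const_term 0 = 0" "const_term 1 = 1" "const_term (const c) = c"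
  "const_term (letter x) = 0" "const_term (f \<circ>\<^sub>z g) = 0"
  by (transfer; simp)+

lemma deriv_simps [simp]:
  "deriv x (f + g) = deriv x f + deriv x g"
  "deriv x (f - g) = deriv x f - deriv x g"
  "deriv x (- f) = - deriv x f"
  "deriv x (f * g) = deriv x f * g + f * deriv x g"
  "deriv x 0 = 0" "deriv x 1 = 0" "deriv x (const c) = 0"
  "deriv x (letter y) = (if x = y then 1 else 0)"
  "deriv x (f \<circ>\<^sub>z g) = f * deriv x g"
  by (transfer; auto)+

lemma const_hom:
  "const (c + d) = const c + const d" "const (c * d) = const c * const d" "const 1 = 1"
  by (rule shuffle_series_eqI; simp)+

lemma deriv_of_nat [simp]: "deriv x (of_nat n) = 0"
  by (induction n) auto

lemma deriv_numeral [simp]: "deriv x (numeral n) = 0"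
  using deriv_of_nat[of x "numeral n"] by simp

lemma const_term_of_nat [simp]: "const_term (of_nat n) = of_nat n"
  by (induction n) auto

lemma const_of_nat: "const (of_nat n) = of_nat n"
  by (rule shuffle_series_eqI; simp)+

lemma deriv_power [simp]: "deriv x (f ^ n) = of_nat n * f ^ (n - 1) * deriv x f"
proof (induction n)
  case (Suc n)
  have "of_nat n * f ^ (n - 1) * f = of_nat n * f ^ n" by (cases n) (simp_all add: mult_ac)
  then have "of_nat n * f ^ (n - 1) * deriv x f * f = of_nat n * f ^ n * deriv x f"
    by (metis mult.assoc mult.commute)
  with Suc show ?case by (simp add: algebra_simps)
qed simp

lemma zprod_zprod: "f \<circ>\<^sub>z (g \<circ>\<^sub>z h) = (f * g) \<circ>\<^sub>z h"
  by (rule shuffle_series_eqI) (simp_all add: mult.assoc)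

text \<open>Integration by parts; the boundary term is the product of the constant terms. With
  \<open>zprod_zprod\<close> it gives the Zinbiel identity when the first factor has zero constant
  term.\<close>

lemma times_eq_zprod:
  assumes "const_term f = 0 \<or> const_term g = 0"
  shows "f * g = f \<circ>\<^sub>z g + g \<circ>\<^sub>z f"
  by (rule shuffle_series_eqI) (use assms in \<open>auto simp: algebra_simps\<close>)

definition scale_series :: "'k::comm_ring_1 \<Rightarrow> 'k shuffle_series \<Rightarrow> 'k shuffle_series"
  where "scale_series c f = const c * f"

lemma const_term_scale [simp]: "const_term (scale_series c f) = c * const_term f"
  by (simp add: scale_series_def)

lemma scale_mult_series:
  "scale_series c f * g = scale_series c (f * g)" "f * scale_series c g = scale_series c (f * g)"
  by (simp_all add: scale_series_def algebra_simps)

section \<open>The commutator bracket on series\<close>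

abbreviation bracket ::
    "'k::comm_ring_1 shuffle_series \<Rightarrow> 'k shuffle_series \<Rightarrow> 'k shuffle_series"
  where "bracket \<equiv> commutator (\<circ>\<^sub>z)"

lemma deriv_bracket [simp]: "deriv x (bracket f g) = f * deriv x g - g * deriv x f"
  by (simp add: commutator_def)

lemma const_term_bracket [simp]: "const_term (bracket f g) = 0"
  by (simp add: commutator_def)

text \<open>Only a nonassociative algebra: the Zinbiel identity fails for series with constant
  terms, for example with \<open>1\<close> as first two arguments.\<close>

global_interpretation series: nonassoc_algebra scale_series "(\<circ>\<^sub>z)"
  by (unfold_locales; rule shuffle_series_eqI; simp add: scale_series_def const_hom algebra_simps)

text \<open>Both sides have derivative \<open>bracket f g * deriv x h\<close> plus its cyclic
  permutations, as the other terms cancel in pairs. Solved for one product, the identity later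
  trades products for brackets.\<close>

lemma jacobian_bracket:
  "jacobian bracket f g h = f * bracket g h + g * bracket h f + h * bracket f g"
  by (rule shuffle_series_eqI) (simp_all add: jacobian_def algebra_simps)

global_interpretation bracket: tortkara_algebra scale_series bracket
proof unfold_locales
  fix f g h :: "'a shuffle_series"
  show "bracket (bracket f g) (bracket h g) = bracket (jacobian bracket f g h) g"
  proof (rule shuffle_series_eqI)
    fix x
    have J: "deriv x (jacobian bracket f g h)
        = bracket f g * deriv x h + bracket g h * deriv x f + bracket h f * deriv x g"
      by (simp add: jacobian_bracket algebra_simps)
    have "bracket f h = - bracket h f" "bracket h g = - bracket g h" by (simp_all add: commutator_def)
    then show "deriv x (bracket (bracket f g) (bracket h g)) =
        deriv x (bracket (jacobian bracket f g h) g)"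
      unfolding deriv_bracket J by (simp add: jacobian_bracket algebra_simps)
  qed simp
qed (rule shuffle_series_eqI; simp add: scale_series_def const_hom algebra_simps)+

section \<open>Monomials in the letters and their integrals\<close>

definition monomial :: "bool \<Rightarrow> nat \<Rightarrow> nat \<Rightarrow> 'k::comm_ring_1 shuffle_series"
  where "monomial x i j = letter x ^ i * letter (\<not> x) ^ j"

lemma monomial_Not: "monomial (\<not> x) i j = monomial x j i"
  by (simp add: monomial_def mult.commute)

lemma letter_times_monomial: "letter x * monomial x i j = monomial x (Suc i) j"
  "letter (\<not> x) * monomial x i j = monomial x i (Suc j)"
  by (simp_all add: monomial_def)

lemma monomial_times: "monomial x i j * monomial x i' j' = monomial x (i + i') (j + j')"
  by (simp add: monomial_def power_add)

lemma deriv_monomial: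
  "deriv y (monomial x i j)
    = (if y = x then of_nat i * monomial x (i - 1) j else of_nat j * monomial x i (j - 1))"
  by (auto simp: monomial_def)

lemma const_term_monomial: "const_term (monomial x i j) = (if i = 0 \<and> j = 0 then 1 else 0)"
  by (cases i; cases j) (simp_all add: monomial_def)

text \<open>The factor \<open>of_nat j\<close> makes the truncated exponent \<open>j - 1\<close>
  harmless at \<open>j = 0\<close>.\<close>

lemma of_nat_times_monomial:
  "of_nat j * (monomial x (Suc i) (j - 1) * letter (\<not> x)) = of_nat j * (letter x * monomial x i j)"
  by (cases j) (simp_all add: monomial_def mult_ac)

text \<open>Integrates \<open>monomial x i j * t\<close> along \<open>letter x\<close>. The
  remaining integrals have monomials of the same degree \<open>i + j\<close>, but on the left of a
  bracket with \<open>t\<close>, so that integration by parts can lower the degree.\<close>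

lemma monomial_times_zprod_letter:
  fixes t :: "'k::comm_ring_1 shuffle_series"
  shows "of_nat (i + j + 2) * ((monomial x i j * t) \<circ>\<^sub>z letter x)
    = monomial x (Suc i) j * t + of_nat (Suc j) * (monomial x i j \<circ>\<^sub>z bracket t (letter x))
      - of_nat j * (monomial x (Suc i) (j - 1) \<circ>\<^sub>z bracket t (letter (\<not> x)))"
    (is "?L = ?R")
proof (rule shuffle_series_eqI)
  fix y
  define m m' :: "'k shuffle_series" where "m = monomial x i j" and "m' = monomial x (Suc i) (j - 1)"
  define a b d :: "'k shuffle_series"
    where "a = letter x" and "b = letter (\<not> x)" and "d = deriv y t"
  have h: "of_nat j * (m' * b) = of_nat j * (a * m)"
    using of_nat_times_monomial by (simp add: m_def m'_def a_def b_def)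
  have am: "letter x * (q * monomial x i j) = q * monomial x (Suc i) j" for q :: "'k shuffle_series"
    by (simp add: mult.left_commute letter_times_monomial)
  show "deriv y ?L = deriv y ?R"
  proof (cases "y = x")
    case True
    have "deriv y ?R = of_nat (Suc i) * m * t + a * m * d + of_nat (Suc j) * (m * (t - a * d))
        + of_nat j * (m' * b) * d"
      using True by (simp add: deriv_monomial letter_times_monomial m_def m'_def a_def b_def d_def flip: mult.assoc)
    also have "\<dots> = of_nat (i + j + 2) * (m * t)" unfolding h by (simp add: algebra_simps)
    also have "\<dots> = deriv y ?L" using True by (simp add: m_def algebra_simps del: of_nat_add)
    finally show ?thesis ..
  next
    case False
    then have y: "y = (\<not> x)" by auto
    have "deriv y ?R = of_nat j * m' * t + a * m * d - of_nat (Suc j) * (m * a * d)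
        - of_nat j * m' * t + of_nat j * (m' * b) * d"
      using False y by (simp add: deriv_monomial am m_def m'_def a_def b_def d_def algebra_simps)
    also have "\<dots> = 0" unfolding h by (simp add: algebra_simps)
    also have "0 = deriv y ?L" using False by (simp del: of_nat_add)
    finally show ?thesis ..
  qed
qed (simp add: const_term_monomial)

lemma zprod_monomial:
  "f \<circ>\<^sub>z monomial x i j
    = of_nat i * ((monomial x (i - 1) j * f) \<circ>\<^sub>z letter x)
      + of_nat j * ((monomial x i (j - 1) * f) \<circ>\<^sub>z letter (\<not> x))"
  by (rule shuffle_series_eqI) (auto simp: deriv_monomial algebra_simps)

section \<open>Zinbiel ideals generated by bracket ideals\<close>

lemma monomial_False: "monomial False i j = monomial True j i"
  using monomial_Not[of True i j] by simp

lemma subspace_of_nat_times: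
  fixes f :: "'k::field_char_0 shuffle_series"
  assumes "series.subspace X" "f \<in> X"
  shows "of_nat n * f \<in> X"
  using series.subspace_scale[OF assms, of "of_nat n"] by (simp add: scale_series_def const_of_nat)

lemma subspace_of_nat_times_cancel:
  fixes f :: "'k::field_char_0 shuffle_series"
  assumes "series.subspace X" "of_nat n * f \<in> X" "n \<noteq> 0"
  shows "f \<in> X"
proof -
  have "scale_series (1 / of_nat n) (scale_series (of_nat n) f) = f"
    using assms(3) by (simp add: series.scale_scale)
  then show ?thesis
    using series.subspace_scale[OF assms(1,2), of "1 / of_nat n"]
    by (simp add: scale_series_def const_of_nat)
qed

text \<open>Induction on the degree of the monomial: integration by parts and
  \<open>zprod_monomial\<close> turn the remaining integrals of
  \<open>monomial_times_zprod_letter\<close> into ones with monomials of degree one less. The index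
  of \<open>I\<close> is a degree; the family is constant for ideals and graded for the
  basis.\<close>

lemma monomial_times_zprod_letter_mem:
  fixes I :: "nat \<Rightarrow> 'k::field_char_0 shuffle_series set"
  assumes I: "\<And>k t x. t \<in> I k \<Longrightarrow> bracket t (letter x) \<in> I (Suc k)"
    and X: "series.subspace X"
    and mem: "\<And>i j k t. t \<in> I k \<Longrightarrow> i + j + k = Suc n \<Longrightarrow> monomial True i j * t \<in> X"
  shows "t \<in> I k \<Longrightarrow> i + j + k = n \<Longrightarrow> (monomial x i j * t) \<circ>\<^sub>z letter y \<in> X"
proof (induction "i + j" arbitrary: i j k t x y rule: less_induct)
  case less
  have mem': "monomial x i j * t \<in> X" if "t \<in> I k" "i + j + k = Suc n" for x i j k t
    using mem[of t k i j] mem[of t k j i] that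
    by (cases x) (auto simp: monomial_False add.commute)
  have zprod_mem: "monomial y p q \<circ>\<^sub>z bracket t (letter u) \<in> X" if "p + q = i + j" for y p q u
  proof -
    define s where "s = bracket t (letter u)"
    have s: "s \<in> I (Suc k)" using I less.prems by (simp add: s_def)
    have "of_nat p * ((monomial y (p - 1) q * s) \<circ>\<^sub>z letter y) \<in> X"
    proof (cases p)
      case (Suc p')
      then show ?thesis using less.hyps[of p' q s "Suc k" y y] that less.prems(2) s
        by (auto intro!: subspace_of_nat_times[OF X] simp del: of_nat_Suc)
    qed (simp add: series.subspace_0[OF X])
    moreover have "of_nat q * ((monomial y p (q - 1) * s) \<circ>\<^sub>z letter (\<not> y)) \<in> X"
    proof (cases q)
      case (Suc q')
      then show ?thesis using less.hyps[of p q' s "Suc k" y "\<not> y"] that less.prems(2) s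
        by (auto intro!: subspace_of_nat_times[OF X] simp del: of_nat_Suc)
    qed (simp add: series.subspace_0[OF X])
    ultimately have "s \<circ>\<^sub>z monomial y p q \<in> X"
      unfolding zprod_monomial by (rule series.subspace_add[OF X])
    moreover have "monomial y p q * s \<in> X" using mem'[OF s] that less.prems(2) by simp
    \<comment> \<open>The bracket \<open>s\<close> has no constant term, so integration by parts
      applies even to the monomial \<open>1\<close>.\<close>
    moreover have "monomial y p q \<circ>\<^sub>z s = monomial y p q * s - s \<circ>\<^sub>z monomial y p q"
      using times_eq_zprod[of "monomial y p q" s] by (simp add: s_def)
    ultimately show ?thesis using series.subspace_diff[OF X] by (simp add: s_def)
  qed
  have *: "(monomial y p q * t) \<circ>\<^sub>z letter y \<in> X" if "p + q = i + j" for p q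
  proof (rule subspace_of_nat_times_cancel[OF X, of "p + q + 2"])
    have "of_nat q * (monomial y (Suc p) (q - 1) \<circ>\<^sub>z bracket t (letter (\<not> y))) \<in> X"
    proof (cases q)
      case (Suc q')
      then show ?thesis using zprod_mem[of "Suc p" q' y] that
        by (auto intro!: subspace_of_nat_times[OF X] simp del: of_nat_Suc)
    qed (simp add: series.subspace_0[OF X])
    then show "of_nat (p + q + 2) * ((monomial y p q * t) \<circ>\<^sub>z letter y) \<in> X"
      unfolding monomial_times_zprod_letter
      using mem'[OF less.prems(1)] less.prems(2) that
        subspace_of_nat_times[OF X zprod_mem[of p q y y], of "Suc q"]
      by (intro series.subspace_diff[OF X] series.subspace_add[OF X]) auto
  qed simp
  show ?case using *[of i j] *[of j i]
    by (cases x; cases y) (simp_all add: monomial_False add.commute)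
qed

text \<open>The submodule generated by \<open>I\<close> over the polynomials in the two letters,
  with the shuffle product.\<close>

definition monomial_span :: "'k::field_char_0 shuffle_series set \<Rightarrow> 'k shuffle_series set"
  where "monomial_span I = series.span {monomial True i j * t | i j t. t \<in> I}"

lemma subspace_monomial_span: "series.subspace (monomial_span I)"
  by (simp add: monomial_span_def)

lemma monomial_times_mem: "t \<in> I \<Longrightarrow> monomial x i j * t \<in> monomial_span I"
  unfolding monomial_span_def
  by (cases x) (auto simp: monomial_False intro!: series.span_base)

lemma subset_monomial_span: "I \<subseteq> monomial_span I"
  using monomial_times_mem[of _ I True 0 0] by (auto simp: monomial_def)

lemma monomial_span_mono: "I \<subseteq> I' \<Longrightarrow> monomial_span I \<subseteq> monomial_span I'"
  unfolding monomial_span_def by (rule series.span_mono) auto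

lemma monomial_span_induct [consumes 1, case_names zero add monomial]:
  assumes "f \<in> monomial_span I" "P 0" "\<And>f g. P f \<Longrightarrow> P g \<Longrightarrow> P (f + g)"
    "\<And>i j t c. t \<in> I \<Longrightarrow> P (scale_series c (monomial True i j * t))"
  shows "P f"
  using assms(1) unfolding monomial_span_def
  by (induction rule: series.span_induct_alt) (auto intro: assms)

lemma monomial_span_times_monomial:
  assumes "f \<in> monomial_span I"
  shows "monomial x i j * f \<in> monomial_span I"
  using assms
proof (induction rule: monomial_span_induct)
  case (monomial p q t c)
  have "\<exists>p' q'. monomial x i j * monomial True p q = (monomial True p' q' :: 'a shuffle_series)"
    by (cases x) (auto simp: monomial_False monomial_times)
  then show ?case
    using monomial_times_mem[OF monomial]
    by (metis mult.assoc scale_mult_series(2) series.subspace_scale subspace_monomial_span)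
qed (auto simp: algebra_simps intro: series.subspace_0 series.subspace_add subspace_monomial_span)

lemma monomial_span_times_letter:
  "f \<in> monomial_span I \<Longrightarrow> letter x * f \<in> monomial_span I"
  using monomial_span_times_monomial[of f I x 1 0] by (simp add: monomial_def)

section \<open>The bracket subalgebra and its ideals\<close>

abbreviation bracket_word :: "bool list \<Rightarrow> 'k::field_char_0 shuffle_series"
  where "bracket_word \<equiv> left_normed_commutator bracket letter"

text \<open>A linear span, but closed under \<open>bracket\<close> since this satisfies the Tortkara
  identity; hence the subalgebra generated by the letters.\<close>

abbreviation bracket_closure :: "'k::field_char_0 shuffle_series set"
  where "bracket_closure \<equiv> bracket.two_generated_span letter"

lemma letter_mem_bracket_closure [simp]: "letter x \<in> bracket_closure"
  and bracket_word_mem_bracket_closure [simp]: "bracket_word w \<in> bracket_closure"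
  by (auto simp: bracket.two_generated_span_def intro: series.span_base)

lemma bracket_mem_bracket_closure:
  "s \<in> bracket_closure \<Longrightarrow> t \<in> bracket_closure \<Longrightarrow> bracket s t \<in> bracket_closure"
  using bracket.subalgebra_two_generated_span unfolding subalgebra_def by blast

lemma subspace_bracket_closure: "series.subspace bracket_closure"
  by (simp add: bracket.two_generated_span_def)

lemma const_term_bracket_word [simp]: "const_term (bracket_word w) = 0"
  by (cases w) simp_all

text \<open>Makes integration by parts, and hence the Zinbiel identity, available on this
  span.\<close>

lemma const_term_monomial_span:
  assumes "f \<in> monomial_span bracket_closure"
  shows "const_term f = 0"
  using assms
proof (induction rule: monomial_span_induct)
  case (monomial i j t c)
  then have "const_term t = 0"
    unfolding bracket.two_generated_span_def
    by (induction rule: series.span_induct_alt) auto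
  then show ?case by simp
qed simp_all

text \<open>Used twice: with \<open>bracket_closure\<close> itself, to see that its monomial span is
  closed under \<open>\<circ>\<^sub>z\<close>, and with the kernel of \<rho>, to obtain the
  ideal.\<close>

locale bracket_ideal =
  fixes I :: "'k::field_char_0 shuffle_series set"
  assumes subspace: "series.subspace I"
    and bracket_mem: "t \<in> I \<Longrightarrow> s \<in> bracket_closure \<Longrightarrow> bracket t s \<in> I"
begin

abbreviation J where "J \<equiv> monomial_span I"

lemmas J_add = series.subspace_add[OF subspace_monomial_span[of I]]
  and J_diff = series.subspace_diff[OF subspace_monomial_span[of I]]
  and J_scale = series.subspace_scale[OF subspace_monomial_span[of I]]
  and J_0 = series.subspace_0[OF subspace_monomial_span[of I]]

lemma bracket_mem': "t \<in> I \<Longrightarrow> s \<in> bracket_closure \<Longrightarrow> bracket s t \<in> I"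
  using series.subspace_neg[OF subspace bracket_mem[of t s]] bracket.anticommutative[of s t] by simp

lemma zprod_letter_mem:
  assumes "f \<in> J"
  shows "f \<circ>\<^sub>z letter x \<in> J"
  using assms
proof (induction rule: monomial_span_induct)
  case (monomial i j t c)
  have "(monomial True i j * t) \<circ>\<^sub>z letter x \<in> J"
    by (rule monomial_times_zprod_letter_mem[where I = "\<lambda>k. I" and n = "i + j" and k = 0])
      (auto intro: bracket_mem subspace_monomial_span monomial_times_mem monomial)
  then show ?case by (simp add: series.mult_scale_left J_scale)
qed (auto simp: series.mult_add_left J_add J_0)

lemma jacobian_mem:
  assumes "s \<in> I" "p \<in> bracket_closure" "q \<in> bracket_closure"
  shows "jacobian bracket p q s \<in> I"
proof -
  have "bracket p q \<in> bracket_closure" using assms bracket_mem_bracket_closure by blast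
  then show ?thesis unfolding jacobian_def
    using assms by (intro series.subspace_add[OF subspace] bracket_mem bracket_mem')
qed

text \<open>Solve \<open>jacobian_bracket\<close> for the product with the outermost bracket: the
  Jacobian lies in \<open>I\<close>, one term is a letter times an element of \<open>I\<close>, and
  the other has the shorter word \<open>w\<close>.\<close>

lemma bracket_word_times_mem: "s \<in> I \<Longrightarrow> bracket_word w * s \<in> J"
proof (induction w arbitrary: s)
  case Nil
  have "bracket_word [] * s = jacobian bracket (letter True) (letter False) s
      - letter True * bracket (letter False) s - letter False * bracket s (letter True)"
    by (simp add: jacobian_bracket algebra_simps)
  also have "\<dots> \<in> J"
    using Nil
    by (intro J_diff monomial_span_times_letter subsetD[OF subset_monomial_span] jacobian_mem
        bracket_mem[of s] bracket_mem'[of s]) simp_all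
  finally show ?case .
next
  case (Cons x w)
  have "bracket_word (x # w) * s = jacobian bracket (bracket_word w) (letter x) s
      - bracket_word w * bracket (letter x) s - letter x * bracket s (bracket_word w)"
    by (simp add: jacobian_bracket algebra_simps)
  also have "\<dots> \<in> J"
    using Cons
    by (intro J_diff monomial_span_times_letter Cons.IH)
      (simp_all add: subsetD[OF subset_monomial_span] jacobian_mem bracket_mem bracket_mem')
  finally show ?case .
qed

lemma bracket_closure_times_mem:
  assumes "t \<in> bracket_closure" "s \<in> I"
  shows "t * s \<in> J"
  using assms(1) unfolding bracket.two_generated_span_def
proof (induction rule: series.span_induct_alt)
  case (step c x y)
  have "x * s \<in> J"
    using step(1) bracket_word_times_mem assms(2) monomial_span_times_letter subset_monomial_span
    by blast
  then show ?case using step(2) by (simp add: distrib_right scale_mult_series J_add J_scale)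
qed (simp add: J_0)

lemma times_mem_aux:
  assumes "t \<in> bracket_closure" "f \<in> J"
  shows "t * f \<in> J"
  using assms(2)
proof (induction rule: monomial_span_induct)
  case (monomial i j s c)
  have "monomial True i j * (t * s) \<in> J"
    using monomial bracket_closure_times_mem[OF assms(1)] monomial_span_times_monomial by blast
  then show ?case by (simp add: scale_mult_series mult.left_commute J_scale)
qed (auto simp: algebra_simps J_add J_0)

lemma times_mem:
  assumes "f \<in> monomial_span bracket_closure" "h \<in> J"
  shows "f * h \<in> J"
  using assms(1)
proof (induction rule: monomial_span_induct)
  case (monomial i j t c)
  have "monomial True i j * (t * h) \<in> J"
    using times_mem_aux[OF monomial assms(2)] monomial_span_times_monomial by blast
  then show ?case by (simp add: scale_mult_series mult.assoc J_scale)
qed (auto simp: algebra_simps J_add J_0)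

text \<open>By \<open>zprod_zprod\<close>, expanding the outermost bracket leaves an integral along
  a letter and one along the shorter word, the latter with \<open>letter x * h\<close> in place of
  \<open>h\<close>.\<close>

lemma zprod_bracket_word_mem: "h \<in> J \<Longrightarrow> h \<circ>\<^sub>z bracket_word w \<in> J"
proof (induction w arbitrary: h)
  case Nil
  have "h \<circ>\<^sub>z bracket_word [] = (letter True * h) \<circ>\<^sub>z letter False - (letter False * h) \<circ>\<^sub>z letter True"
    by (simp add: commutator_def series.mult_diff_right zprod_zprod mult.commute)
  then show ?case using Nil by (auto intro: J_diff zprod_letter_mem monomial_span_times_letter)
next
  case (Cons x w)
  have "h \<circ>\<^sub>z bracket_word (x # w) = (bracket_word w * h) \<circ>\<^sub>z letter x - (letter x * h) \<circ>\<^sub>z bracket_word w"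
    by (simp add: commutator_def series.mult_diff_right zprod_zprod mult.commute)
  also have "\<dots> \<in> J"
    using Cons.prems Cons.IH[OF monomial_span_times_letter[OF Cons.prems, of x]]
    by (intro J_diff zprod_letter_mem times_mem_aux) simp_all
  finally show ?case .
qed

lemma zprod_bracket_closure_mem:
  assumes "t \<in> bracket_closure" "h \<in> J"
  shows "h \<circ>\<^sub>z t \<in> J"
  by (rule series.mult_span_right[OF assms(1)[unfolded bracket.two_generated_span_def]])
    (use assms zprod_bracket_word_mem zprod_letter_mem subspace_monomial_span in auto)

lemma zprod_monomial_mem:
  assumes "h \<in> J"
  shows "h \<circ>\<^sub>z monomial x i j \<in> J"
  unfolding zprod_monomial
  using assms by (intro J_add subspace_of_nat_times[OF subspace_monomial_span] zprod_letter_mem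
      monomial_span_times_monomial)

text \<open>The product rule for \<open>monomial True i j * t\<close> reduces to integrals along
  \<open>t\<close> and along the monomial.\<close>

lemma zprod_mem_right:
  assumes "f \<in> monomial_span bracket_closure" "h \<in> J"
  shows "h \<circ>\<^sub>z f \<in> J"
  using assms(1)
proof (induction rule: monomial_span_induct)
  case (monomial i j t c)
  have "h \<circ>\<^sub>z (monomial True i j * t)
      = (monomial True i j * h) \<circ>\<^sub>z t + (t * h) \<circ>\<^sub>z monomial True i j"
    by (rule shuffle_series_eqI) (simp_all add: algebra_simps)
  also have "\<dots> \<in> J"
    using assms(2) monomial by (intro J_add zprod_bracket_closure_mem zprod_monomial_mem
        times_mem_aux monomial_span_times_monomial)
  finally show ?case by (simp add: series.mult_scale_right J_scale)
qed (auto simp: series.mult_add_right J_add J_0)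

text \<open>Reduced to right multiplication by integration by parts, since \<open>h\<close> has no
  constant term.\<close>

lemma zprod_mem_left:
  assumes "I \<subseteq> bracket_closure" "f \<in> monomial_span bracket_closure" "h \<in> J"
  shows "f \<circ>\<^sub>z h \<in> J"
proof -
  have "const_term h = 0" using const_term_monomial_span monomial_span_mono[OF assms(1)] assms(3) by blast
  then have "f \<circ>\<^sub>z h = f * h - h \<circ>\<^sub>z f" using times_eq_zprod[of f h] by simp
  then show ?thesis using times_mem zprod_mem_right assms J_diff by simp
qed

end

section \<open>A monomial basis\<close>

text \<open>\<open>None\<close> marks a pure monomial. The letters are such monomials, so
  \<open>Some\<close> occurs only with bracket words.\<close>

type_synonym basis_index = "nat \<times> nat \<times> bool list option"

fun basis_elem :: "basis_index \<Rightarrow> 'k::field_char_0 shuffle_series"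
  where
    "basis_elem (i, j, None) = monomial True i j"
  | "basis_elem (i, j, Some w) = monomial True i j * bracket_word w"

text \<open>
  Words without, respectively with, a factor \<open>True False\<close>; in the latter case \<open>w\<close> is what follows
  the first such factor. The codes have the degree of the basis elements.
\<close>

fun basis_code :: "basis_index \<Rightarrow> bool list"
  where
    "basis_code (i, j, None) = replicate j False @ replicate i True"
  | "basis_code (i, j, Some w) = replicate j False @ replicate (Suc i) True @ False # w"

lemma inj_basis_code: "inj basis_code"
proof -
  \<comment> \<open>A decoder: it measures the leading blocks of \<open>False\<close> and of
    \<open>True\<close>. What remains is empty exactly for \<open>None\<close>.\<close>
  define split where "split = (\<lambda>w. (length (takeWhile id (dropWhile Not w)),
    length (takeWhile Not w), dropWhile id (dropWhile Not w)))"
  have "split (basis_code (i, j, None)) = (i, j, [])" for i j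
    unfolding split_def by (cases i) (simp_all add: takeWhile_append dropWhile_append)
  moreover have "split (basis_code (i, j, Some w)) = (Suc i, j, False # w)" for i j w
    by (simp add: split_def takeWhile_append dropWhile_append)
  ultimately have "split (basis_code (i, j, v)) = split (basis_code (i', j', v')) \<Longrightarrow>
      (i, j, v) = (i', j', v')" for i j v i' j' v'
    by (cases v; cases v') simp_all
  then show ?thesis by (metis injI prod_cases3)
qed

abbreviation basis_degree :: "basis_index \<Rightarrow> nat"
  where "basis_degree p \<equiv> length (basis_code p)"

lift_definition word_series :: "bool list \<Rightarrow> 'k::comm_ring_1 shuffle_series"
  is "\<lambda>w v. if v = w then 1 else 0" .

lemma coeff_scale_series: "coeff (scale_series c f) w = c * coeff f w"
  unfolding scale_series_def by transfer (rule shuffle_coeff_const_left)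

lemma coeff_sum: "coeff (sum f S) w = (\<Sum>s\<in>S. coeff (f s) w)"
  by (induction S rule: infinite_finite_induct)
    (auto simp: zero_shuffle_series.rep_eq plus_shuffle_series.rep_eq)

lemma inj_word_series: "inj (word_series :: _ \<Rightarrow> 'k::comm_ring_1 shuffle_series)"
proof (rule injI)
  fix v w assume "word_series v = (word_series w :: 'k shuffle_series)"
  then have "coeff (word_series v :: 'k shuffle_series) v = coeff (word_series w) v" by (rule arg_cong)
  then show "v = w" by (simp add: word_series.rep_eq split: if_splits)
qed

lemma independent_word_series:
  "series.independent (range (word_series :: _ \<Rightarrow> 'k::field_char_0 shuffle_series))"
  unfolding series.independent_explicit_finite_subsets
proof (intro allI impI ballI)
  fix S and u :: "'k shuffle_series \<Rightarrow> 'k" and v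
  assume S: "S \<subseteq> range word_series" "finite S"
    and sum: "(\<Sum>v\<in>S. scale_series (u v) v) = 0" and v: "v \<in> S"
  obtain w where w: "v = word_series w" using S v by auto
  have coeff: "coeff s w = (if s = v then 1 else 0)" if "s \<in> S" for s
  proof -
    obtain w' where "s = word_series w'" using S(1) \<open>s \<in> S\<close> by auto
    then show ?thesis by (auto simp: w word_series.rep_eq inj_eq[OF inj_word_series])
  qed
  have "coeff (\<Sum>v\<in>S. scale_series (u v) v) w = (\<Sum>s\<in>S. if s = v then u s else 0)"
    unfolding coeff_sum coeff_scale_series by (rule sum.cong) (simp_all add: coeff)
  also have "\<dots> = u v" using S(2) v by simp
  finally show "u v = 0" by (simp add: sum zero_shuffle_series.rep_eq)
qed

text \<open>Words arise from \<open>1\<close> by repeated integration along letters, so spanning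
  reduces to closure under these integrations.\<close>

lemma word_series_Cons: "word_series (x # w) = word_series w \<circ>\<^sub>z letter x"
proof -
  have *: "deriv y (word_series (x # w)) = (if y = x then word_series w else 0)" for y
    by transfer auto
  have "const_term (word_series (x # w)) = 0" by transfer simp
  then show ?thesis by - (rule shuffle_series_eqI; simp add: *)
qed

section \<open>Spanning in each degree\<close>

definition basis_span :: "nat \<Rightarrow> 'k::field_char_0 shuffle_series set"
  where "basis_span n = series.span (basis_elem ` {p. basis_degree p = n})"

lemma basis_elem_mem_basis_span: "basis_degree p = n \<Longrightarrow> basis_elem p \<in> basis_span n"
  unfolding basis_span_def by (rule series.span_base) blast

lemma monomial_mem_basis_span: "i + j = n \<Longrightarrow> monomial x i j \<in> basis_span n"
  using basis_elem_mem_basis_span[of "(i, j, None)" n] basis_elem_mem_basis_span[of "(j, i, None)" n]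
  by (cases x) (simp_all add: monomial_False)

text \<open>Elements of degree \<open>k\<close> in the bracket subalgebra, arranged as a family to
  which \<open>monomial_times_zprod_letter_mem\<close> applies.\<close>

definition graded_closure :: "nat \<Rightarrow> 'k::field_char_0 shuffle_series set"
  where "graded_closure k = (case k of
      0 \<Rightarrow> {}
    | Suc 0 \<Rightarrow> range letter
    | Suc (Suc n) \<Rightarrow> bracket.left_normed_span letter n)"

lemma graded_closure_bracket:
  fixes t :: "'k::field_char_0 shuffle_series"
  assumes "t \<in> graded_closure k"
  shows "bracket t (letter x) \<in> graded_closure (Suc k)"
proof (cases k)
  case 0
  with assms show ?thesis by (simp add: graded_closure_def)
next
  case (Suc l)
  show ?thesis
  proof (cases l)
    case 0
    then obtain y where t: "t = letter y" using assms Suc by (auto simp: graded_closure_def)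
    have z: "bracket (letter True) (letter False :: 'k shuffle_series) \<in> bracket.left_normed_span letter 0"
      by (auto intro!: series.span_base)
    moreover have "bracket (letter False) (letter True) = - bracket (letter True) (letter False :: 'k shuffle_series)"
      by (rule bracket.anticommutative)
    ultimately have "bracket t (letter x) \<in> bracket.left_normed_span letter 0"
      using series.span_neg[OF z] t by (cases x; cases y) (simp_all add: series.span_zero)
    then show ?thesis using Suc 0 by (simp add: graded_closure_def)
  next
    case (Suc m)
    then show ?thesis
      using assms \<open>k = Suc l\<close> bracket.left_normed_span_Suc[of t letter m x]
      by (simp add: graded_closure_def)
  qed
qed

lemma monomial_times_graded_closure:
  fixes t :: "'k::field_char_0 shuffle_series"
  assumes "t \<in> graded_closure k"
  shows "monomial True i j * t \<in> basis_span (i + j + k)"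
proof (cases k)
  case 0
  with assms show ?thesis by (simp add: graded_closure_def)
next
  case (Suc l)
  show ?thesis
  proof (cases l)
    case 0
    then obtain y where "t = letter y" using assms Suc by (auto simp: graded_closure_def)
    then have "monomial True i j * t = (if y then monomial True (Suc i) j else monomial True i (Suc j))"
      by (cases y) (simp_all add: monomial_def mult_ac)
    then show ?thesis using Suc 0 by (simp add: monomial_mem_basis_span)
  next
    case (Suc m)
    then have "t \<in> bracket.left_normed_span letter m"
      using assms \<open>k = Suc l\<close> by (simp add: graded_closure_def)
    then show ?thesis
    proof (induction rule: series.span_induct_alt)
      case base
      show ?case by (simp add: basis_span_def series.span_zero)
    next
      case (step c s t)
      then obtain w where "s = bracket_word w" "length w = m" by auto
      then have "monomial True i j * s \<in> basis_span (i + j + k)"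
        using Suc \<open>k = Suc l\<close> basis_elem_mem_basis_span[of "(i, j, Some w)" "i + j + k"] by simp
      then show ?case
        using step(2) by (simp add: distrib_left scale_mult_series basis_span_def
            series.span_add series.span_scale)
    qed
  qed
qed

lemma basis_span_zprod_letter:
  fixes f :: "'k::field_char_0 shuffle_series"
  assumes "f \<in> basis_span n"
  shows "f \<circ>\<^sub>z letter x \<in> basis_span (Suc n)"
proof -
  have graded: "(monomial True i j * t) \<circ>\<^sub>z letter x \<in> basis_span (Suc n)"
    if "t \<in> graded_closure k" "i + j + k = n" for i j k and t :: "'k shuffle_series"
  proof (rule monomial_times_zprod_letter_mem[OF graded_closure_bracket _ _ that])
    show "series.subspace (basis_span (Suc n) :: 'k shuffle_series set)"
      by (simp add: basis_span_def)
    show "monomial True i j * t \<in> basis_span (Suc n)"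
      if "t \<in> graded_closure k" "i + j + k = Suc n" for i j k and t :: "'k shuffle_series"
      using monomial_times_graded_closure[OF that(1), of i j] that(2) by simp
  qed
  show ?thesis
  proof (rule series.mult_span_left[OF assms[unfolded basis_span_def]])
    fix t :: "'k shuffle_series" assume "t \<in> basis_elem ` {p. basis_degree p = n}"
    then obtain i j v where t: "t = basis_elem (i, j, v)" and n: "basis_degree (i, j, v) = n"
      by auto
    show "t \<circ>\<^sub>z letter x \<in> basis_span (Suc n)"
    proof (cases v)
      case None
      then have t: "t = monomial True i j" and n: "i + j = n" using t n by auto
      \<comment> \<open>A nonconstant monomial splits off a letter, which lies in
        \<open>graded_closure 1\<close>; only the monomial \<open>1\<close> is integrated
        directly.\<close>
      consider "n = 0" | i' where "i = Suc i'" | j' where "j = Suc j'"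
        using n by (cases i; cases j) auto
      then show ?thesis
      proof cases
        case 1
        have "t \<circ>\<^sub>z letter x = monomial x 1 0"
          by (rule shuffle_series_eqI) (use 1 t n in \<open>auto simp: monomial_def\<close>)
        then show ?thesis using 1 by (simp add: monomial_mem_basis_span)
      next
        case 2
        then have "t = monomial True i' j * letter True" using t by (simp add: monomial_def mult_ac)
        then show ?thesis using graded[of "letter True" 1 i' j] 2 n by (simp add: graded_closure_def)
      next
        case 3
        then have "t = monomial True i j' * letter False" using t by (simp add: monomial_def mult_ac)
        then show ?thesis using graded[of "letter False" 1 i j'] 3 n by (simp add: graded_closure_def)
      qed
    next
      case (Some w)
      have "bracket_word w \<in> graded_closure (Suc (Suc (length w)))"
        by (auto simp: graded_closure_def intro!: series.span_base)
      from graded[OF this, of i j] show ?thesis using t n Some by simp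
    qed
  qed (simp add: basis_span_def)
qed

lemma word_series_mem_basis_span:
  "(word_series w :: 'a::field_char_0 shuffle_series) \<in> basis_span (length w)"
proof (induction w)
  case Nil
  have "word_series [] = 1" by transfer (simp add: fun_eq_iff)
  also have "1 = monomial True 0 0" by (simp add: monomial_def)
  finally have "word_series [] = (monomial True 0 0 :: 'a shuffle_series)" .
  then show ?case by (simp add: monomial_mem_basis_span)
next
  case (Cons x w)
  then show ?case by (simp add: word_series_Cons basis_span_zprod_letter)
qed

text \<open>
  The elements of degree at most \<open>N\<close> span all words of length at most \<open>N\<close>, and \<open>basis_code\<close>
  shows that there are no more of them than such words.
\<close>

lemma basis_elem_degree_le:
  fixes N :: nat
  defines "P \<equiv> {p. basis_degree p \<le> N}"
  shows "inj_on (basis_elem :: _ \<Rightarrow> 'k::field_char_0 shuffle_series) P"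
    and "series.independent (basis_elem ` P :: 'k shuffle_series set)"
proof -
  let ?E = "basis_elem ` P :: 'k shuffle_series set"
  define W where "W = {w :: bool list. length w \<le> N}"
  define D where "D = (word_series ` W :: 'k shuffle_series set)"
  have W: "finite W" unfolding W_def using finite_lists_length_le[of "UNIV :: bool set" N] by simp
  have PW: "basis_code ` P \<subseteq> W" by (auto simp: P_def W_def)
  have P: "finite P" "card P \<le> card W"
    using inj_on_finite[OF _ PW W] card_inj_on_le[OF _ PW W] inj_on_subset[OF inj_basis_code] by auto
  have D: "series.independent D" "card D = card W"
    unfolding D_def
    by (rule series.independent_mono[OF independent_word_series], blast)
      (rule card_image[OF inj_on_subset[OF inj_word_series]], blast)
  have span: "D \<subseteq> series.span ?E"
  proof -
    have "basis_span n \<subseteq> series.span ?E" if "n \<le> N" for n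
      unfolding basis_span_def P_def using that by (intro series.span_mono) auto
    then show ?thesis using word_series_mem_basis_span by (auto simp: D_def W_def)
  qed
  have "card D \<le> card ?E"
    using series.independent_span_bound[OF _ D(1) span] P(1) by simp
  moreover have "card ?E \<le> card P" by (rule card_image_le[OF P(1)])
  \<comment> \<open>The chain \<open>card W = card D \<le> card ?E \<le> card P \<le> card W\<close>
    collapses to equalities.\<close>
  ultimately have card: "card ?E = card P" "card ?E = card D" using D(2) P(2) by auto
  show "inj_on (basis_elem :: _ \<Rightarrow> 'k shuffle_series) P" by (rule eq_card_imp_inj_on[OF P(1) card(1)])
  show "series.independent ?E"
  proof
    \<comment> \<open>Without a redundant element, \<open>?E\<close> would still span
      \<open>D\<close> and have too few elements.\<close>
    assume "series.dependent ?E"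
    then obtain b where b: "b \<in> ?E" "b \<in> series.span (?E - {b})" by (auto simp: series.dependent_def)
    have "series.span ?E \<subseteq> series.span (?E - {b})"
      by (rule series.span_minimal) (use b(2) in \<open>auto intro: series.span_base\<close>)
    then have "card D \<le> card (?E - {b})"
      using series.independent_span_bound[OF _ D(1), of "?E - {b}"] P(1) span by auto
    moreover have "card (?E - {b}) < card ?E" using b(1) P(1) by (intro card_Diff1_less) auto
    ultimately show False using card by simp
  qed
qed

lemma inj_basis_elem: "inj (basis_elem :: _ \<Rightarrow> 'k::field_char_0 shuffle_series)"
proof (rule injI)
  fix p q assume "basis_elem p = (basis_elem q :: 'k shuffle_series)"
  then show "p = q"
    using inj_onD[OF basis_elem_degree_le(1)[of "max (basis_degree p) (basis_degree q)"], of p q] by simp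
qed

lemma independent_basis_elem:
  "series.independent (range (basis_elem :: _ \<Rightarrow> 'k::field_char_0 shuffle_series))"
  unfolding series.independent_explicit_finite_subsets
proof (intro allI impI)
  fix S and u :: "'k shuffle_series \<Rightarrow> 'k"
  assume S: "S \<subseteq> range basis_elem" "finite S"
    and sum: "(\<Sum>v\<in>S. scale_series (u v) v) = 0"
  obtain Q where Q: "finite Q" "S = basis_elem ` Q" using finite_subset_image[OF S(2,1)] by auto
  have "Q \<subseteq> {p. basis_degree p \<le> Max (basis_degree ` Q)}" using Q(1) by auto
  then have "S \<subseteq> basis_elem ` {p. basis_degree p \<le> Max (basis_degree ` Q)}" using Q(2) by auto
  then show "\<forall>v\<in>S. u v = 0"
    using basis_elem_degree_le(2)[of "Max (basis_degree ` Q)"] S(2) sum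
    unfolding series.independent_explicit_finite_subsets by blast
qed

section \<open>Quotients and speciality\<close>

text \<open>
  The quotient of the subalgebra \<open>Z\<close> by the ideal \<open>J\<close> is realised on the ambient type by
  composing all products with a linear projection \<open>r\<close> onto a complement of \<open>J\<close> in \<open>Z\<close>.
\<close>

lemma special_quotient:
  fixes scaleA :: "'k::field_char_0 \<Rightarrow> 'a::ab_group_add \<Rightarrow> 'a"
    and scaleB :: "'k \<Rightarrow> 'b::ab_group_add \<Rightarrow> 'b"
  assumes A: "nonassoc_algebra scaleA multA"
    and Z: "subalgebra scaleA multA Z"
    and zinbiel: "\<And>a b c. a \<in> Z \<Longrightarrow> b \<in> Z \<Longrightarrow> c \<in> Z \<Longrightarrow>
      multA a (multA b c) = multA (multA a b + multA b a) c"
    and J: "module.subspace scaleA J" "J \<subseteq> Z"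
      "\<And>a h. a \<in> Z \<Longrightarrow> h \<in> J \<Longrightarrow> multA a h \<in> J \<and> multA h a \<in> J"
    and T: "subalgebra scaleA (commutator multA) T" "T \<subseteq> Z"
    and lin: "Vector_Spaces.linear scaleA scaleB \<rho>"
    and surj: "\<rho> ` T = UNIV"
    and hom: "\<And>s t. s \<in> T \<Longrightarrow> t \<in> T \<Longrightarrow> \<rho> (commutator multA s t) = multB (\<rho> s) (\<rho> t)"
    and ker: "\<And>t. t \<in> T \<Longrightarrow> \<rho> t = 0 \<Longrightarrow> t \<in> J" "\<And>h. h \<in> J \<Longrightarrow> \<rho> h = 0"
  shows "special scaleB multB"
proof -
  interpret A: nonassoc_algebra scaleA multA by (rule A)
  interpret \<rho>: Vector_Spaces.linear scaleA scaleB \<rho> by (rule lin)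
  interpret AA: vector_space_pair scaleA scaleA ..
  interpret AB: vector_space_pair scaleA scaleB ..
  have Zsub: "A.subspace Z" and Zmult: "\<And>a b. a \<in> Z \<Longrightarrow> b \<in> Z \<Longrightarrow> multA a b \<in> Z"
    and Tsub: "A.subspace T" and Tcom: "\<And>a b. a \<in> T \<Longrightarrow> b \<in> T \<Longrightarrow> commutator multA a b \<in> T"
    using Z T by (auto simp: subalgebra_def)
  have id: "Vector_Spaces.linear scaleA scaleA (\<lambda>x. x)" by unfold_locales auto
  obtain e where e: "range e \<subseteq> Z" "Vector_Spaces.linear scaleA scaleA e" "\<And>a. a \<in> Z \<Longrightarrow> e a = a"
    using AA.linear_exists_left_inverse_on[OF id Zsub] by auto
  obtain p where p: "range p \<subseteq> J" "Vector_Spaces.linear scaleA scaleA p" "\<And>a. a \<in> J \<Longrightarrow> p a = a"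
    using AA.linear_exists_left_inverse_on[OF id J(1)] by auto
  obtain g where g: "range g \<subseteq> T" "Vector_Spaces.linear scaleB scaleA g" "\<And>y. \<rho> (g y) = y"
    using AB.linear_exists_right_inverse_on[OF lin Tsub] surj by auto
  interpret e: Vector_Spaces.linear scaleA scaleA e by (rule e)
  interpret p: Vector_Spaces.linear scaleA scaleA p by (rule p)
  interpret g: Vector_Spaces.linear scaleB scaleA g by (rule g)
  define r where "r = (\<lambda>a. e a - p (e a))"
  \<comment> \<open>Applying \<open>r\<close> to the arguments first moves them into
    \<open>Z\<close>, so the Zinbiel identity holds on the whole type.\<close>
  define m where "m = (\<lambda>a b. r (multA (r a) (r b)))"
  interpret r: Vector_Spaces.linear scaleA scaleA r
    unfolding r_def
    by unfold_locales (simp_all add: e.add p.add e.scale p.scale A.scale_right_diff_distrib)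
  have r_Z: "r a \<in> Z" for a
    unfolding r_def using e(1) p(1) J(2) by (intro A.subspace_diff[OF Zsub]) auto
  have r_diff: "a - r a \<in> J" if "a \<in> Z" for a using that e(3) p(1) by (auto simp: r_def)
  have r_J: "r h = 0" if "h \<in> J" for h using that e(3) p(3) J(2) by (auto simp: r_def)
  have r_cong: "r a = r b" if "a - b \<in> J" for a b using r_J[OF that] by (simp add: r.diff)
  have r_r: "r (r a) = r a" if "a \<in> Z" for a using r_cong[OF r_diff[OF that]] by simp
  have r_right: "r (multA a (r b)) = r (multA a b)" if "a \<in> Z" "b \<in> Z" for a b
    using J(3)[OF that(1) r_diff[OF that(2)]] by (intro r_cong[symmetric]) (simp add: A.mult_diff_right)
  have r_left: "r (multA (r a) b) = r (multA a b)" if "a \<in> Z" "b \<in> Z" for a b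
    using J(3)[OF that(2) r_diff[OF that(1)]] by (intro r_cong[symmetric]) (simp add: A.mult_diff_left)
  have "zinbiel_algebra scaleA m"
  proof unfold_locales
    fix a b c
    define a' b' c' where "a' = r a" and "b' = r b" and "c' = r c"
    have Z': "a' \<in> Z" "b' \<in> Z" "c' \<in> Z" by (simp_all add: r_Z a'_def b'_def c'_def)
    note closed = Zmult A.subspace_add[OF Zsub] Z'
    have "m a (m b c) = r (multA a' (multA b' c'))"
      by (simp add: m_def r_r r_right closed flip: a'_def b'_def c'_def)
    also have "\<dots> = r (multA (multA a' b' + multA b' a') c')" by (simp add: zinbiel Z')
    also have "\<dots> = r (multA (r (multA a' b' + multA b' a')) c')"
      by (rule r_left[symmetric]) (intro closed)+
    also have "\<dots> = m (m a b + m b a) c"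
      by (simp add: m_def r.add r_r closed flip: a'_def b'_def c'_def)
    finally show "m a (m b c) = m (m a b + m b a) c" .
  qed (simp_all add: m_def r.add r.scale A.mult_add_left A.mult_add_right A.mult_scale_left
      A.mult_scale_right)
  moreover have "special_in scaleB multB scaleA m"
  proof -
    define f where "f = r \<circ> g"
    have f_lin: "Vector_Spaces.linear scaleB scaleA f"
      unfolding f_def using Vector_Spaces.linear_compose g(2) r.linear_axioms by blast
    interpret f: Vector_Spaces.linear scaleB scaleA f by (rule f_lin)
    have gT: "g y \<in> T" "g y \<in> Z" for y using g(1) T(2) by auto
    have f_mult: "f (multB x y) = commutator m (f x) (f y)" for x y
    proof -
      \<comment> \<open>The section \<open>g\<close> is multiplicative only modulo \<open>J\<close>:
        the defect lies in \<open>T\<close> and is killed by \<rho>.\<close>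
      have "g (multB x y) - commutator multA (g x) (g y) \<in> J"
        by (rule ker) (simp_all add: A.subspace_diff Tsub Tcom gT \<rho>.diff g(3) hom)
      then have "f (multB x y) = r (commutator multA (g x) (g y))" by (simp add: f_def r_cong)
      then show ?thesis
        by (simp add: f_def m_def commutator_def r.diff r_r r_left r_right gT r_Z)
    qed
    have "inj f"
      unfolding f.inj_iff_eq_0
    proof (intro allI impI)
      fix y assume "f y = 0"
      then have "g y \<in> J" using r_diff[OF gT(2)[of y]] by (simp add: f_def)
      then show "y = 0" using ker(2) g(3) by metis
    qed
    moreover have "subalgebra scaleA (commutator m) (range f)"
      using f.subspace_image[OF \<rho>.vs2.subspace_UNIV] f_mult[symmetric]
      by (auto simp: subalgebra_def)
    ultimately show ?thesis
      unfolding special_in_def algebra_hom_def using f_lin f_mult by (auto simp: bij_betw_def)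
  qed
  ultimately show ?thesis by (rule special_if_special_in)
qed

text \<open>Allows the graph of a map between Tortkara algebras to be studied as a
  subalgebra.\<close>

lemma tortkara_algebra_prod:
  assumes A: "tortkara_algebra scaleA multA" and B: "tortkara_algebra scaleB multB"
  shows "tortkara_algebra (\<lambda>c (a, b). (scaleA c a, scaleB c b))
    (\<lambda>(a, b) (a', b'). (multA a a', multB b b'))"
proof -
  interpret A: tortkara_algebra scaleA multA by (rule A)
  interpret B: tortkara_algebra scaleB multB by (rule B)
  show ?thesis
  proof unfold_locales
    fix u v :: "'b \<times> 'c"
    show "(case u of (a, b) \<Rightarrow> \<lambda>(a', b'). (multA a a', multB b b')) v
      = - (case v of (a, b) \<Rightarrow> \<lambda>(a', b'). (multA a a', multB b b')) u"
      using A.anticommutative[of "fst u" "fst v"] B.anticommutative[of "snd u" "snd v"]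
      by (simp add: case_prod_unfold)
  next
    fix u v w :: "'b \<times> 'c"
    let ?m = "\<lambda>(a, b) (a', b'). (multA a a', multB b b')"
    show "?m (?m u v) (?m w v) = ?m (jacobian ?m u v w) v"
      using A.tortkara[of "fst u" "fst v" "fst w"] B.tortkara[of "snd u" "snd v" "snd w"]
      by (simp add: jacobian_def case_prod_unfold)
  qed (auto simp: A.scale_right_distrib B.scale_right_distrib A.scale_left_distrib
      B.scale_left_distrib A.mult_add_left B.mult_add_left A.mult_add_right B.mult_add_right
      A.mult_scale_left B.mult_scale_left A.mult_scale_right B.mult_scale_right)
qed

section \<open>The linear map onto a two-generated algebra\<close>

context tortkara_algebra
begin

lemma two_generated_span_eq_UNIV:
  assumes "subalgebra scale (\<cdot>) hull (range c) = UNIV"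
  shows "two_generated_span c = UNIV"
proof -
  have "range c \<subseteq> two_generated_span c" by (auto simp: two_generated_span_def intro: span_base)
  then have "subalgebra scale (\<cdot>) hull (range c) \<subseteq> two_generated_span c"
    using subalgebra_two_generated_span[of c] by (rule hull_minimal)
  with assms show ?thesis by blast
qed

text \<open>Values of \<rho> on the basis. In the first case \<open>i\<close> is the exponent of the
  letter \<open>True\<close>, so \<open>i = 1\<close> selects the generator; the constant
  \<open>1\<close> goes to \<open>0\<close>.\<close>

fun generator_value :: "(bool \<Rightarrow> 'a) \<Rightarrow> basis_index \<Rightarrow> 'a"
  where
    "generator_value c (i, j, None) = (if i + j = 1 then c (i = 1) else 0)"
  | "generator_value c (i, j, Some w) = (if i + j = 0 then left_normed_commutator (\<cdot>) c w else 0)"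

lemma special_if_generated:
  fixes c :: "bool \<Rightarrow> 'a"
  assumes gen: "subalgebra scale (\<cdot>) hull (range c) = UNIV"
  shows "special scale (\<cdot>)"
proof -
  let ?g = "left_normed_commutator (\<cdot>) c"
  interpret ZB: vector_space_pair scale_series scale ..
  obtain \<rho> :: "'k shuffle_series \<Rightarrow> 'a" where lin: "Vector_Spaces.linear scale_series scale \<rho>"
    and "\<forall>f\<in>range basis_elem. \<rho> f = generator_value c (inv basis_elem f)"
    using ZB.linear_independent_extend[OF independent_basis_elem,
        where f = "\<lambda>f. generator_value c (inv basis_elem f)"] by blast
  then have \<rho>: "\<rho> (basis_elem p) = generator_value c p" for p
    by (metis inj_basis_elem inv_f_f rangeI)
  interpret \<rho>: Vector_Spaces.linear scale_series scale \<rho> by (rule lin)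
  have \<rho>_letter: "\<rho> (letter x) = c x" for x
    using \<rho>[of "(1, 0, None)"] \<rho>[of "(0, 1, None)"] by (cases x) (simp_all add: monomial_def)
  have \<rho>_word: "\<rho> (bracket_word w) = ?g w" for w
    using \<rho>[of "(0, 0, Some w)"] by (simp add: monomial_def)
  \<comment> \<open>Here a monomial times a letter is a basis monomial of degree at least two, where
    \<open>generator_value\<close> vanishes.\<close>
  have \<rho>_monomial: "\<rho> (monomial True i j * t) = 0" if "t \<in> bracket_closure" "i + j \<noteq> 0" for i j t
    using that(1) unfolding bracket.two_generated_span_def
  proof (induction rule: series.span_induct_alt)
    case (step a s t)
    have "monomial True i j * letter True = (monomial True (Suc i) j :: 'k shuffle_series)"
      "monomial True i j * letter False = (monomial True i (Suc j) :: 'k shuffle_series)"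
      by (simp_all add: monomial_def mult_ac)
    then have "\<rho> (monomial True i j * letter x) = 0" for x
      using \<rho>[of "(Suc i, j, None)"] \<rho>[of "(i, Suc j, None)"] that(2) by (cases x) auto
    moreover have "\<rho> (monomial True i j * bracket_word w) = 0" for w
      using \<rho>[of "(i, j, Some w)"] that(2) by auto
    ultimately have "\<rho> (monomial True i j * s) = 0" using step(1) by auto
    then show ?case using step(2) by (simp add: distrib_left scale_mult_series \<rho>.add \<rho>.scale)
  qed simp

  \<comment> \<open>\<open>\<rho>\<close> is multiplicative on the bracket closure because its graph there is the subalgebra of the
    product algebra generated by the pairs of generators\<close>
  define scaleP where "scaleP = (\<lambda>k (f :: 'k shuffle_series, b). (scale_series k f, k *s b))"
  define multP where "multP = (\<lambda>(f :: 'k shuffle_series, b) (f', b'). (bracket f f', b \<cdot> b'))"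
  define d where "d = (\<lambda>x. (letter x :: 'k shuffle_series, c x))"
  have d: "d x = (letter x, c x)" for x by (simp add: d_def)
  interpret P: tortkara_algebra scaleP multP
    unfolding scaleP_def multP_def
    by (rule tortkara_algebra_prod[OF bracket.tortkara_algebra_axioms tortkara_algebra_axioms])
  have word_d: "left_normed_commutator multP d w = (bracket_word w, ?g w)" for w
    by (induction w) (simp_all add: multP_def d)
  have graph: "f \<in> bracket_closure \<and> b = \<rho> f" if "(f, b) \<in> P.two_generated_span d" for f b
  proof -
    have "fst u \<in> bracket_closure \<and> snd u = \<rho> (fst u)" if "u \<in> P.two_generated_span d" for u
      using that unfolding P.two_generated_span_def
    proof (induction rule: P.span_induct_alt)
      case base
      show ?case using series.subspace_0[OF subspace_bracket_closure] by simp
    next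
      case (step k s u)
      have "fst s \<in> bracket_closure \<and> snd s = \<rho> (fst s)"
        using step(1) by (auto simp: word_d d \<rho>_letter \<rho>_word)
      moreover have "scaleP k s = (scale_series k (fst s), k *s snd s)"
        by (cases s) (simp add: scaleP_def)
      ultimately show ?case using step(2)
        by (auto simp: \<rho>.add \<rho>.scale intro!: series.subspace_add series.subspace_scale
            subspace_bracket_closure)
    qed
    from this[OF that] show ?thesis by simp
  qed
  have graph': "(t, \<rho> t) \<in> P.two_generated_span d" if "t \<in> bracket_closure" for t
    using that unfolding bracket.two_generated_span_def
  proof (induction rule: series.span_induct_alt)
    case base
    have "0 \<in> P.two_generated_span d" by (simp add: P.two_generated_span_def P.span_zero)
    then show ?case by (simp add: zero_prod_def)
  next
    case (step k s t)
    have "(s, \<rho> s) \<in> range d \<union> range (left_normed_commutator multP d)"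
      using step(1) by (auto simp: word_d d \<rho>_letter \<rho>_word image_iff)
    then have "scaleP k (s, \<rho> s) + (t, \<rho> t) \<in> P.two_generated_span d"
      using step(2) unfolding P.two_generated_span_def
      by (intro P.span_add P.span_scale) (auto intro: P.span_base)
    then show ?case by (simp add: scaleP_def \<rho>.add \<rho>.scale)
  qed
  have hom: "\<rho> (bracket s t) = \<rho> s \<cdot> \<rho> t" if "s \<in> bracket_closure" "t \<in> bracket_closure" for s t
  proof -
    \<comment> \<open>Closure in the product algebra expands both coordinates of a product with the
      same coefficients.\<close>
    have "multP (s, \<rho> s) (t, \<rho> t) \<in> P.two_generated_span d"
      using P.subalgebra_two_generated_span[of d] graph' that by (simp add: subalgebra_def)
    then show ?thesis using graph by (auto simp: multP_def)
  qed

  define I where "I = {t \<in> bracket_closure. \<rho> t = 0}"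
  interpret T: bracket_ideal "bracket_closure :: 'k shuffle_series set"
    by unfold_locales (rule subspace_bracket_closure, rule bracket_mem_bracket_closure)
  interpret I: bracket_ideal I
  proof
    show "series.subspace I"
      using subspace_bracket_closure unfolding I_def series.subspace_def
      by (auto simp: \<rho>.add \<rho>.scale)
  qed (auto simp: I_def hom bracket_mem_bracket_closure)
  have ker: "\<rho> h = 0" if "h \<in> monomial_span I" for h
    using that
  proof (induction rule: monomial_span_induct)
    case (monomial i j t k)
    show ?case
    proof (cases "i + j = 0")
      case True
      with monomial show ?thesis by (simp add: I_def monomial_def \<rho>.scale)
    next
      case False
      with monomial \<rho>_monomial[of t i j] show ?thesis by (simp add: I_def \<rho>.scale)
    qed
  qed (simp_all add: \<rho>.add)
  have IT: "I \<subseteq> bracket_closure" by (auto simp: I_def)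
  have surj: "\<rho> ` bracket_closure = UNIV"
  proof -
    have "\<rho> ` bracket_closure = span (range c \<union> range ?g)"
      unfolding bracket.two_generated_span_def \<rho>.span_image[symmetric]
      by (simp add: image_Un image_image \<rho>_letter \<rho>_word)
    then show ?thesis using two_generated_span_eq_UNIV[OF gen] by (simp add: two_generated_span_def)
  qed
  have zinbiel: "f \<circ>\<^sub>z (g \<circ>\<^sub>z h) = (f \<circ>\<^sub>z g + g \<circ>\<^sub>z f) \<circ>\<^sub>z h"
    if "f \<in> monomial_span bracket_closure" for f g h :: "'k shuffle_series"
    using times_eq_zprod[of f g] const_term_monomial_span[OF that] by (simp add: zprod_zprod)
  show ?thesis
  proof (rule special_quotient[OF series.nonassoc_algebra_axioms _ zinbiel subspace_monomial_span
        monomial_span_mono[OF IT] _ bracket.subalgebra_two_generated_span subset_monomial_span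
        lin surj hom _ ker])
    show "subalgebra scale_series (\<circ>\<^sub>z) (monomial_span bracket_closure :: 'k shuffle_series set)"
      by (simp add: subalgebra_def subspace_monomial_span T.zprod_mem_right)
    show "f \<circ>\<^sub>z h \<in> monomial_span I \<and> h \<circ>\<^sub>z f \<in> monomial_span I"
      if "f \<in> monomial_span bracket_closure" "h \<in> monomial_span I" for f h
      using that I.zprod_mem_left[OF IT] I.zprod_mem_right by blast
    show "t \<in> monomial_span I" if "t \<in> bracket_closure" "\<rho> t = 0" for t
      using that subset_monomial_span[of I] by (auto simp: I_def)
  qed
qed

end

theorem corollary2p7:
  fixes scale :: "'k::field_char_0 \<Rightarrow> 'b::ab_group_add \<Rightarrow> 'b"
    and mult :: "'b \<Rightarrow> 'b \<Rightarrow> 'b"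
  assumes "tortkara_algebra scale mult"
    and "generated_by_two scale mult"
  shows "special scale mult"
proof -
  obtain x y where "subalgebra scale mult hull {x, y} = UNIV"
    using assms(2) by (auto simp: generated_by_two_def)
  moreover have "range (\<lambda>b. if b then x else y) = {x, y}" by auto
  ultimately show ?thesis using tortkara_algebra.special_if_generated[OF assms(1)] by metis
qed

end
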